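(* The problem of computing an office allocation satisfying Global Proportional Justified Representation is fixed-parameter tractable with respect to the number of voters $n$. That is, there are a computable function $f$, a polynomial $p$, and an algorithm which, given any election instance consisting of $k\ge 1$ offices with pairwise disjoint nonempty finite candidate sets $A_1,\dots,A_k$ and $n\ge 1$ voters with approval ballots $v_1,\dots,v_n\subseteq A=\bigcup_{j\in[k]}A_j$, outputs an office allocation satisfying Global Proportional Justified Representation in time at most $f(n)\cdot p(N)$, where $N$ is the size of the instance.
   Context: Setting. $[k]=\{1,\dots,k\}$. There are $k$ offices; office $j$ has a nonempty finite set $A_j$ of candidates, the sets $A_1,\dots,A_k$ are pairwise disjoint, and $A=\bigcup_{j\in[k]}A_j$. There are $n$ voters $V=\{v_1,\dots,v_n\}$; each voter $v$ is identified with her approval ballot $v\subseteq A$ (different voters may have identical ballots and are still counted separately, so $|V|=n$). An office allocation is a set $X=\{w_1,\dots,w_k\}$ with $w_j\in A_j$ for every $j\in[k]$. Definition (Global Proportional Justified Representation). An office allocation $X$ satisfies Global Proportional Justified Representation if for every nonempty group of voters $V'\subseteq V$ the following holds: if $\left(\bigcap_{v\in V'}v\right)\cap A_j\neq\emptyset$ for all $j\in[k]$, then $\left|X\cap\left(\bigcup_{v\in V'}v\right)\right|\ge\left\lfloor\frac{|V'|}{|V|}\,k\right\rfloor$. *)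

theory Defs
  imports
    Complex_Main
    "HOL-Library.Disjoint_Sets"
    "HOL-Library.Log_Nat"
    "HOL-Computational_Algebra.Polynomial"
begin

section \<open>Elections of office allocations\<close>

text \<open>Offices are indexed by \<open>{1..offices E}\<close> and voters by \<open>{1..voters E}\<close>; since voters are
  indices, voters with identical ballots are counted separately.  The values of
  \<^term>\<open>candidates\<close> and \<^term>\<open>ballot\<close> outside these ranges are irrelevant.\<close>

record 'c election =
  offices :: nat
  candidates :: "nat \<Rightarrow> 'c set"
  voters :: nat
  ballot :: "nat \<Rightarrow> 'c set"

definition election_instance :: "'c election \<Rightarrow> bool" where
  "election_instance E \<longleftrightarrow>
     offices E \<ge> 1 \<and> voters E \<ge> 1 \<and>
     (\<forall>j\<in>{1..offices E}. finite (candidates E j) \<and> candidates E j \<noteq> {}) \<and>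
     disjoint_family_on (candidates E) {1..offices E} \<and>
     (\<forall>i\<in>{1..voters E}. ballot E i \<subseteq> (\<Union>j\<in>{1..offices E}. candidates E j))"

definition office_allocation :: "'c election \<Rightarrow> 'c set \<Rightarrow> bool" where
  "office_allocation E X \<longleftrightarrow>
     (\<exists>w. (\<forall>j\<in>{1..offices E}. w j \<in> candidates E j) \<and> X = w ` {1..offices E})"

definition global_PJR :: "'c election \<Rightarrow> 'c set \<Rightarrow> bool" where
  "global_PJR E X \<longleftrightarrow>
     (\<forall>V'. V' \<subseteq> {1..voters E} \<and> V' \<noteq> {} \<and>
        (\<forall>j\<in>{1..offices E}. (\<Inter>i\<in>V'. ballot E i) \<inter> candidates E j \<noteq> {}) \<longrightarrow>
        int (card (X \<inter> (\<Union>i\<in>V'. ballot E i)))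
          \<ge> \<lfloor>real (card V') / real (voters E) * real (offices E)\<rfloor>)"


section \<open>Random access machines\<close>

text \<open>A random access machine with a read-only input tape, a write-only output tape, and
  registers \<open>R\<^sub>0, R\<^sub>1, \<dots>\<close> holding natural numbers, all initially zero.  Every instruction costs
  one unit.  The only arithmetic is addition and truncated subtraction, so one step lengthens
  the longest stored number by at most one bit (apart from constants and inputs); hence the
  uniform cost measure is polynomially related to Turing machine time.\<close>

datatype instr =
    Const nat nat     \<comment> \<open>\<open>Const r c\<close>: \<open>R\<^sub>r := c\<close>\<close>
  | Add nat nat nat   \<comment> \<open>\<open>Add r s t\<close>: \<open>R\<^sub>r := R\<^sub>s + R\<^sub>t\<close>\<close>
  | Sub nat nat nat   \<comment> \<open>\<open>Sub r s t\<close>: \<open>R\<^sub>r := R\<^sub>s - R\<^sub>t\<close>, truncated at zero\<close>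
  | Load nat nat      \<comment> \<open>\<open>Load r s\<close>: \<open>R\<^sub>r :=\<close> content of the register with address \<open>R\<^sub>s\<close>\<close>
  | Store nat nat     \<comment> \<open>\<open>Store r s\<close>: register with address \<open>R\<^sub>r\<close> \<open>:= R\<^sub>s\<close>\<close>
  | Jump nat          \<comment> \<open>\<open>Jump l\<close>: continue with instruction number \<open>l\<close>\<close>
  | JumpZ nat nat     \<comment> \<open>\<open>JumpZ r l\<close>: likewise, if \<open>R\<^sub>r = 0\<close>\<close>
  | Read nat          \<comment> \<open>\<open>Read r\<close>: next input number into \<open>R\<^sub>r\<close>, or zero if there is none\<close>
  | Write nat         \<comment> \<open>\<open>Write r\<close>: append \<open>R\<^sub>r\<close> to the output\<close>

record config =
  pc :: nat
  mem :: "nat \<Rightarrow> nat"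
  in_tape :: "nat list"
  out_tape :: "nat list"

fun exec_instr :: "instr \<Rightarrow> config \<Rightarrow> config" where
  "exec_instr (Const r c) \<sigma> = \<sigma>\<lparr>pc := pc \<sigma> + 1, mem := (mem \<sigma>)(r := c)\<rparr>"
| "exec_instr (Add r s t) \<sigma> = \<sigma>\<lparr>pc := pc \<sigma> + 1, mem := (mem \<sigma>)(r := mem \<sigma> s + mem \<sigma> t)\<rparr>"
| "exec_instr (Sub r s t) \<sigma> = \<sigma>\<lparr>pc := pc \<sigma> + 1, mem := (mem \<sigma>)(r := mem \<sigma> s - mem \<sigma> t)\<rparr>"
| "exec_instr (Load r s) \<sigma> = \<sigma>\<lparr>pc := pc \<sigma> + 1, mem := (mem \<sigma>)(r := mem \<sigma> (mem \<sigma> s))\<rparr>"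
| "exec_instr (Store r s) \<sigma> = \<sigma>\<lparr>pc := pc \<sigma> + 1, mem := (mem \<sigma>)(mem \<sigma> r := mem \<sigma> s)\<rparr>"
| "exec_instr (Jump l) \<sigma> = \<sigma>\<lparr>pc := l\<rparr>"
| "exec_instr (JumpZ r l) \<sigma> = \<sigma>\<lparr>pc := (if mem \<sigma> r = 0 then l else pc \<sigma> + 1)\<rparr>"
| "exec_instr (Read r) \<sigma> =
     \<sigma>\<lparr>pc := pc \<sigma> + 1,
       mem := (mem \<sigma>)(r := (case in_tape \<sigma> of [] \<Rightarrow> 0 | x # _ \<Rightarrow> x)),
       in_tape := tl (in_tape \<sigma>)\<rparr>"
| "exec_instr (Write r) \<sigma> = \<sigma>\<lparr>pc := pc \<sigma> + 1, out_tape := out_tape \<sigma> @ [mem \<sigma> r]\<rparr>"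

text \<open>The machine halts when the program counter leaves the program; a halted configuration is
  a fixed point of \<open>ram_step\<close>.\<close>

definition halted :: "instr list \<Rightarrow> config \<Rightarrow> bool" where
  "halted P \<sigma> \<longleftrightarrow> length P \<le> pc \<sigma>"

definition ram_step :: "instr list \<Rightarrow> config \<Rightarrow> config" where
  "ram_step P \<sigma> = (if halted P \<sigma> then \<sigma> else exec_instr (P ! pc \<sigma>) \<sigma>)"

definition initial_config :: "nat list \<Rightarrow> config" where
  "initial_config xs = \<lparr>pc = 0, mem = (\<lambda>_. 0), in_tape = xs, out_tape = []\<rparr>"

text \<open>On input \<open>xs\<close>, program \<open>P\<close> halts after at most \<open>t\<close> steps with output \<open>ys\<close>.\<close>

definition ram_outputs_within :: "instr list \<Rightarrow> nat list \<Rightarrow> nat \<Rightarrow> nat list \<Rightarrow> bool" where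
  "ram_outputs_within P xs t ys \<longleftrightarrow>
     (let \<sigma> = (ram_step P ^^ t) (initial_config xs) in halted P \<sigma> \<and> out_tape \<sigma> = ys)"

definition computable_fun :: "(nat \<Rightarrow> nat) \<Rightarrow> bool" where
  "computable_fun f \<longleftrightarrow> (\<exists>P. \<forall>n. \<exists>t. ram_outputs_within P [n] t [f n])"


section \<open>Encoding of instances\<close>

definition enumerates :: "'a list \<Rightarrow> 'a set \<Rightarrow> bool" where
  "enumerates xs S \<longleftrightarrow> distinct xs \<and> set xs = S"

text \<open>Candidates are named by arbitrary natural numbers.  The input consists of \<open>k\<close>, \<open>n\<close> and then,
  each preceded by its length, lists of the sets \<open>A\<^sub>1, \<dots>, A\<^sub>k, v\<^sub>1, \<dots>, v\<^sub>n\<close> in an arbitrary order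
  of their elements, so an instance has several encodings.\<close>

definition encodes_election :: "nat list \<Rightarrow> nat election \<Rightarrow> bool" where
  "encodes_election xs E \<longleftrightarrow>
     (\<exists>as vs. list_all2 enumerates as (map (candidates E) [1..<offices E + 1]) \<and>
              list_all2 enumerates vs (map (ballot E) [1..<voters E + 1]) \<and>
              xs = offices E # voters E # concat (map (\<lambda>ys. length ys # ys) (as @ vs)))"

text \<open>The size is the total length of the binary representations of the input numbers, where
  \<open>0\<close> is represented by one digit.\<close>

definition input_size :: "nat list \<Rightarrow> nat" where
  "input_size xs = (\<Sum>x\<leftarrow>xs. max 1 (floorlog 2 x))"

end

theory Submission
  imports Defs
begin

text \<open>A sequential Phragmen rule with integer budgets solves the problem in polynomial time, so a
  constant \<open>f\<close> suffices.  For \<open>k\<close> rounds every voter receives one coin, and after each payout every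
  vacant office with a candidate whose supporters together own \<open>n\<close> coins is filled with such a
  candidate, who takes exactly \<open>n\<close> coins from her supporters.  Offices still vacant after round \<open>k\<close>
  are filled arbitrarily.  Let a group of voters \<open>U\<close> agree on a candidate for every office.  After
  round \<open>k\<close> it owns fewer than \<open>n\<close> coins: either an office is vacant, and its common candidate there
  is not affordable, or \<open>k\<close> offices have been paid for with \<open>k n\<close> coins and nobody owns anything.
  Since a candidate takes coins from \<open>U\<close> only if somebody in \<open>U\<close> approves her, and at most \<open>n\<close> of
  them, \<open>U\<close> approves more than \<open>k |U| / n - 1\<close> of the elected candidates.\<close>

section \<open>Timed Hoare logic for random access machines\<close>

type_synonym store = "(nat \<Rightarrow> nat) \<times> nat list \<times> nat list"

text \<open>The effect of an instruction without the program counter. The last clause is a default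
  for jumps, which \<open>straight\<close> keeps out of blocks.\<close>

fun eff :: "instr \<Rightarrow> store \<Rightarrow> store" where
  "eff (Const r c) (m, i, out) = (m(r := c), i, out)"
| "eff (Add r s t) (m, i, out) = (m(r := m s + m t), i, out)"
| "eff (Sub r s t) (m, i, out) = (m(r := m s - m t), i, out)"
| "eff (Load r s) (m, i, out) = (m(r := m (m s)), i, out)"
| "eff (Store r s) (m, i, out) = (m(m r := m s), i, out)"
| "eff (Read r) (m, i, out) = (m(r := (case i of [] \<Rightarrow> 0 | x # _ \<Rightarrow> x)), tl i, out)"
| "eff (Write r) (m, i, out) = (m, i, out @ [m r])"
| "eff _ s = s"

fun straight :: "instr \<Rightarrow> bool" where
  "straight (Jump l) = False"
| "straight (JumpZ r l) = False"
| "straight _ = True"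

text \<open>\<open>If0\<close> has no alternative branch and runs its body when the register is
  zero; \<open>While\<close> repeats its body as long as the register is nonzero.\<close>

datatype com =
    Block "instr list"
  | Seq com com (infixr \<open>;;\<close> 60)
  | If0 nat com
  | While nat com

fun csize :: "com \<Rightarrow> nat" where
  "csize (Block is) = length is"
| "csize (a ;; b) = csize a + csize b"
| "csize (If0 r a) = csize a + 2"
| "csize (While r a) = csize a + 2"

text \<open>Jump targets are absolute, so the first argument is the address at which the code will
  be placed. The extra \<open>Jump\<close> in \<open>If0\<close> makes up for the missing jump on a
  nonzero register.\<close>

fun compile :: "nat \<Rightarrow> com \<Rightarrow> instr list" where
  "compile l (Block is) = is"
| "compile l (a ;; b) = compile l a @ compile (l + csize a) b"
| "compile l (If0 r a) = JumpZ r (l + 2) # Jump (l + 2 + csize a) # compile (l + 2) a"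
| "compile l (While r a) = JumpZ r (l + 2 + csize a) # compile (Suc l) a @ [Jump l]"

lemma length_compile [simp]: "length (compile l c) = csize c"
  by (induction c arbitrary: l) auto

section \<open>Reaching a program point within a time bound\<close>

definition store_of :: "config \<Rightarrow> store" where
  "store_of \<sigma> = (mem \<sigma>, in_tape \<sigma>, out_tape \<sigma>)"

definition reaches :: "instr list \<Rightarrow> nat \<Rightarrow> config \<Rightarrow> nat \<Rightarrow> (store \<Rightarrow> bool) \<Rightarrow> bool" where
  "reaches Pg T \<sigma> l Q \<longleftrightarrow>
     (\<exists>t\<le>T. pc ((ram_step Pg ^^ t) \<sigma>) = l \<and> Q (store_of ((ram_step Pg ^^ t) \<sigma>)))"

text \<open>Total correctness within \<open>T\<close> steps. The quantification over the surrounding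
  code \<open>pre\<close> and \<open>post\<close> makes triples independent of the position of the
  code and hence composable.\<close>

definition hoare :: "nat \<Rightarrow> (store \<Rightarrow> bool) \<Rightarrow> com \<Rightarrow> (store \<Rightarrow> bool) \<Rightarrow> bool" where
  "hoare T P c Q \<longleftrightarrow>
     (\<forall>pre post \<sigma>. pc \<sigma> = length pre \<longrightarrow> P (store_of \<sigma>) \<longrightarrow>
        reaches (pre @ compile (length pre) c @ post) T \<sigma> (length pre + csize c) Q)"

lemma reaches_0: "pc \<sigma> = l \<Longrightarrow> Q (store_of \<sigma>) \<Longrightarrow> reaches Pg T \<sigma> l Q"
  unfolding reaches_def by (intro exI[of _ 0]) simp

lemma reaches_step: "reaches Pg T (ram_step Pg \<sigma>) l Q \<Longrightarrow> reaches Pg (Suc T) \<sigma> l Q"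
  unfolding reaches_def by (metis Suc_le_mono funpow_Suc_right comp_apply)

lemma reaches_trans:
  assumes "reaches Pg T \<sigma> l R"
    and "\<And>\<sigma>'. pc \<sigma>' = l \<Longrightarrow> R (store_of \<sigma>') \<Longrightarrow> reaches Pg T' \<sigma>' l' Q"
  shows "reaches Pg (T + T') \<sigma> l' Q"
proof -
  obtain t where t: "t \<le> T" "pc ((ram_step Pg ^^ t) \<sigma>) = l" "R (store_of ((ram_step Pg ^^ t) \<sigma>))"
    using assms(1) by (auto simp: reaches_def)
  obtain t' where t': "t' \<le> T'"
    "pc ((ram_step Pg ^^ t') ((ram_step Pg ^^ t) \<sigma>)) = l'"
    "Q (store_of ((ram_step Pg ^^ t') ((ram_step Pg ^^ t) \<sigma>)))"
    using assms(2)[OF t(2,3)] by (auto simp: reaches_def)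
  show ?thesis unfolding reaches_def
    using t(1) t' by (intro exI[of _ "t' + t"]) (auto simp: funpow_add)
qed

lemma reaches_mono: "reaches Pg T \<sigma> l Q \<Longrightarrow> T \<le> T' \<Longrightarrow> reaches Pg T' \<sigma> l Q"
  using le_trans[of _ T T'] unfolding reaches_def by blast

section \<open>Proof rules for timed triples\<close>

lemma hoare_weaken:
  assumes "hoare T P c Q" "\<And>s. P' s \<Longrightarrow> P s" "\<And>s. Q s \<Longrightarrow> Q' s" "T \<le> T'"
  shows "hoare T' P' c Q'"
  using assms unfolding hoare_def reaches_def by (meson le_trans)

lemma hoare_fix: "(\<And>s. P s \<Longrightarrow> hoare T (\<lambda>s'. s' = s) c Q) \<Longrightarrow> hoare T P c Q"
  unfolding hoare_def by blast

lemma ram_step_straight: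
  assumes "pc \<sigma> = length pre" "straight i"
  shows "pc (ram_step (pre @ i # post) \<sigma>) = Suc (length pre)"
    and "store_of (ram_step (pre @ i # post) \<sigma>) = eff i (store_of \<sigma>)"
  using assms by (cases i; simp add: ram_step_def halted_def store_of_def nth_append)+

lemma hoare_Block:
  assumes "list_all straight is" "\<And>s. P s \<Longrightarrow> Q (fold eff is s)" "length is \<le> T"
  shows "hoare T P (Block is) Q"
proof -
  have "reaches (pre @ is @ post) (length is) \<sigma> (length pre + length is) Q"
    if "pc \<sigma> = length pre" "Q (fold eff is (store_of \<sigma>))" for pre post :: "instr list" and \<sigma>
    using that assms(1)
  proof (induction "is" arbitrary: pre \<sigma>)
    case Nil
    then show ?case by (simp add: reaches_0)
  next
    case (Cons i "is")
    note st = ram_step_straight[OF Cons.prems(1), of i "is @ post"]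
    show ?case
      using Cons.IH[of "ram_step (pre @ i # is @ post) \<sigma>" "pre @ [i]"] Cons.prems st
      by (auto intro!: reaches_step)
  qed
  then show ?thesis
    using assms(2,3) unfolding hoare_def compile.simps csize.simps by (meson reaches_mono)
qed

lemma hoare_Seq:
  assumes a: "hoare T\<^sub>1 P a R" and b: "hoare T\<^sub>2 R b Q" and T: "T\<^sub>1 + T\<^sub>2 \<le> T"
  shows "hoare T P (a ;; b) Q"
  unfolding hoare_def
proof (intro allI impI)
  fix pre post :: "instr list" and \<sigma> assume \<sigma>: "pc \<sigma> = length pre" "P (store_of \<sigma>)"
  let ?a = "compile (length pre) a" and ?b = "compile (length pre + csize a) b"
  have "reaches (pre @ ?a @ ?b @ post) (T\<^sub>1 + T\<^sub>2) \<sigma> (length pre + (csize a + csize b)) Q"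
  proof (rule reaches_trans)
    show "reaches (pre @ ?a @ ?b @ post) T\<^sub>1 \<sigma> (length pre + csize a) R"
      using a \<sigma> unfolding hoare_def by blast
    show "reaches (pre @ ?a @ ?b @ post) T\<^sub>2 \<sigma>' (length pre + (csize a + csize b)) Q"
      if "pc \<sigma>' = length pre + csize a" "R (store_of \<sigma>')" for \<sigma>'
      using b[unfolded hoare_def, rule_format, of \<sigma>' "pre @ ?a" post] that by (simp add: add.assoc)
  qed
  then show "reaches (pre @ compile (length pre) (a ;; b) @ post) T \<sigma>
      (length pre + csize (a ;; b)) Q"
    using T by (auto intro: reaches_mono)
qed

text \<open>Entering the body costs one step and skipping it costs two, so \<open>2\<close> extra
  steps cover both cases.\<close>

lemma hoare_If0:
  assumes a: "hoare T (\<lambda>s. P s \<and> fst s r = 0) a Q"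
    and skip: "\<And>s. P s \<Longrightarrow> fst s r \<noteq> 0 \<Longrightarrow> Q s" and T: "T + 2 \<le> T'"
  shows "hoare T' P (If0 r a) Q"
  unfolding hoare_def
proof (intro allI impI)
  fix pre post :: "instr list" and \<sigma> assume \<sigma>: "pc \<sigma> = length pre" "P (store_of \<sigma>)"
  let ?l = "length pre"
  let ?js = "[JumpZ r (?l + 2), Jump (?l + 2 + csize a)]"
  let ?Pg = "pre @ compile ?l (If0 r a) @ post"
  have Pg: "?Pg = (pre @ ?js) @ compile (length (pre @ ?js)) a @ post" by simp
  have at: "?Pg ! ?l = JumpZ r (?l + 2)" "?Pg ! Suc ?l = Jump (?l + 2 + csize a)"
    by (simp_all add: nth_append)
  have s1: "ram_step ?Pg \<sigma> = \<sigma>\<lparr>pc := (if mem \<sigma> r = 0 then ?l + 2 else ?l + 1)\<rparr>"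
    using \<sigma> at unfolding ram_step_def halted_def by simp
  show "reaches ?Pg T' \<sigma> (?l + csize (If0 r a)) Q"
  proof (cases "mem \<sigma> r = 0")
    case True
    have "reaches ?Pg T (ram_step ?Pg \<sigma>) (length (pre @ ?js) + csize a) Q"
      unfolding Pg using \<sigma> True s1[unfolded Pg]
      by (intro a[unfolded hoare_def, rule_format]) (simp_all add: store_of_def)
    then show ?thesis
      using T by (auto dest!: reaches_step intro: reaches_mono)
  next
    case False
    have s2: "ram_step ?Pg (ram_step ?Pg \<sigma>) = \<sigma>\<lparr>pc := ?l + 2 + csize a\<rparr>"
      using False at s1 unfolding ram_step_def halted_def by simp
    have "Q (store_of \<sigma>)" using skip[OF \<sigma>(2)] False by (simp add: store_of_def)
    then have "reaches ?Pg 0 (ram_step ?Pg (ram_step ?Pg \<sigma>)) (?l + csize (If0 r a)) Q"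
      unfolding s2 by (intro reaches_0) (simp_all add: store_of_def)
    then show ?thesis
      by (rule reaches_mono[OF reaches_step[OF reaches_step]]) (use T in simp)
  qed
qed

text \<open>The invariant is indexed by the number of iterations still to come, which also gives
  termination. Each iteration pays one step for the test and one for the jump back; the final
  \<open>1\<close> is the failing test.\<close>

lemma hoare_While:
  assumes body: "\<And>i. hoare T (I (Suc i)) c (I i)"
    and guard: "\<And>i s. I i s \<Longrightarrow> fst s r = 0 \<longleftrightarrow> i = 0"
    and T: "i * (T + 2) + 1 \<le> T'"
  shows "hoare T' (I i) (While r c) (I 0)"
  unfolding hoare_def
proof (intro allI impI)
  fix pre post :: "instr list" and \<sigma> assume "pc \<sigma> = length pre" "I i (store_of \<sigma>)"
  let ?l = "length pre"
  let ?Pg = "pre @ compile ?l (While r c) @ post"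
  have at: "?Pg ! ?l = JumpZ r (?l + 2 + csize c)" "?Pg ! (Suc ?l + csize c) = Jump ?l"
    by (simp_all add: nth_append)
  have len: "?l + csize c + 2 \<le> length ?Pg" by simp
  have "reaches ?Pg (i * (T + 2) + 1) \<sigma> (?l + csize (While r c)) (I 0)"
    if "pc \<sigma> = ?l" "I i (store_of \<sigma>)" for \<sigma>
    using that
  proof (induction i arbitrary: \<sigma>)
    case 0
    have "mem \<sigma> r = 0" using guard[OF 0(2)] by (simp add: store_of_def)
    then have "ram_step ?Pg \<sigma> = \<sigma>\<lparr>pc := ?l + 2 + csize c\<rparr>"
      using 0(1) at len unfolding ram_step_def halted_def by simp
    then show ?case
      using 0(2) by (auto intro!: reaches_step reaches_0 simp: store_of_def)
  next
    case (Suc i)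
    have "mem \<sigma> r \<noteq> 0" using guard[OF Suc.prems(2)] by (simp add: store_of_def)
    then have s1: "ram_step ?Pg \<sigma> = \<sigma>\<lparr>pc := Suc ?l\<rparr>"
      using Suc.prems(1) at len unfolding ram_step_def halted_def by simp
    have "reaches ?Pg (T + (1 + (i * (T + 2) + 1))) (ram_step ?Pg \<sigma>) (?l + csize (While r c)) (I 0)"
    proof (rule reaches_trans)
      have Pg: "?Pg = (pre @ [JumpZ r (?l + 2 + csize c)]) @
          compile (length (pre @ [JumpZ r (?l + 2 + csize c)])) c @ Jump ?l # post" by simp
      show "reaches ?Pg T (ram_step ?Pg \<sigma>) (Suc ?l + csize c) (I i)"
        using body[of i, unfolded hoare_def, rule_format, of "ram_step ?Pg \<sigma>"
            "pre @ [JumpZ r (?l + 2 + csize c)]" "Jump ?l # post", folded Pg] Suc.prems s1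
        by (simp add: store_of_def)
      fix \<sigma>' assume \<sigma>': "pc \<sigma>' = Suc ?l + csize c" "I i (store_of \<sigma>')"
      have s2: "ram_step ?Pg \<sigma>' = \<sigma>'\<lparr>pc := ?l\<rparr>"
        using \<sigma>' at len unfolding ram_step_def halted_def by simp
      have "reaches ?Pg (i * (T + 2) + 1) (ram_step ?Pg \<sigma>') (?l + csize (While r c)) (I 0)"
        using \<sigma>' by (intro Suc.IH; unfold s2) (simp_all add: store_of_def)
      then show "reaches ?Pg (1 + (i * (T + 2) + 1)) \<sigma>' (?l + csize (While r c)) (I 0)"
        using reaches_step by fastforce
    qed
    then show ?case
      by (rule reaches_mono[OF reaches_step]) simp
  qed
  then show "reaches ?Pg T' \<sigma> (?l + csize (While r c)) (I 0)"
    using \<open>pc \<sigma> = length pre\<close> \<open>I i (store_of \<sigma>)\<close> T by (blast intro: reaches_mono)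
qed

text \<open>Here the index is the list still to be processed. Its length counts the iterations, and
  quantifying over all lists of that length reduces the rule to \<open>hoare_While\<close>.\<close>

lemma hoare_While_list:
  assumes body: "\<And>x xs. hoare T (I (x # xs)) c (I xs)"
    and guard: "\<And>xs s. I xs s \<Longrightarrow> fst s r = 0 \<longleftrightarrow> xs = []"
    and T: "length xs * (T + 2) + 1 \<le> T'"
  shows "hoare T' (I xs) (While r c) (I [])"
proof -
  have "hoare T' (\<lambda>s. \<exists>ys. length ys = length xs \<and> I ys s) (While r c)
      (\<lambda>s. \<exists>ys. length ys = 0 \<and> I ys s)"
  proof (rule hoare_While[where I = "\<lambda>i s. \<exists>ys. length ys = i \<and> I ys s", OF _ _ T])
    show "hoare T (\<lambda>s. \<exists>ys. length ys = Suc i \<and> I ys s) c (\<lambda>s. \<exists>ys. length ys = i \<and> I ys s)" for i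
      using body unfolding hoare_def reaches_def by (fastforce simp: length_Suc_conv)
  qed (use guard in fastforce)
  then show ?thesis
    by (rule hoare_weaken) auto
qed

section \<open>Symbolic execution from a single known store\<close>

lemma exec_Block:
  "list_all straight is \<Longrightarrow> Q (fold eff is s) \<Longrightarrow> length is \<le> T \<Longrightarrow>
     hoare T (\<lambda>s'. s' = s) (Block is) Q"
  by (rule hoare_Block) auto

lemma exec_Seq:
  "list_all straight is \<Longrightarrow> length is \<le> T \<Longrightarrow>
     hoare (T - length is) (\<lambda>s'. s' = fold eff is s) c Q \<Longrightarrow> hoare T (\<lambda>s'. s' = s) (Block is ;; c) Q"
  by (rule hoare_Seq[OF hoare_Block[OF _ _ order_refl]]) auto

lemma exec_If0:
  "(fst s r = 0 \<Longrightarrow> hoare (T - 2) (\<lambda>s'. s' = s) a Q) \<Longrightarrow> (fst s r \<noteq> 0 \<Longrightarrow> Q s) \<Longrightarrow> 2 \<le> T \<Longrightarrow>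
     hoare T (\<lambda>s'. s' = s) (If0 r a) Q"
  by (rule hoare_If0[where T = "T - 2"]) (auto simp: hoare_def)

lemma hoare_program:
  assumes "hoare T (\<lambda>s. s = (\<lambda>_. 0, xs, [])) c (\<lambda>(m, i, out). out = ys)"
  shows "ram_outputs_within (compile 0 c) xs T ys"
proof -
  let ?P = "compile 0 c"
  obtain t where t: "t \<le> T" "pc ((ram_step ?P ^^ t) (initial_config xs)) = csize c"
    "out_tape ((ram_step ?P ^^ t) (initial_config xs)) = ys"
    using assms[unfolded hoare_def reaches_def, rule_format, of "initial_config xs" "[]" "[]"]
    by (auto simp: initial_config_def store_of_def)
  \<comment> \<open>A halted configuration is a fixed point, so arrival at some
    \<open>t \<le> T\<close> determines the configuration at time exactly \<open>T\<close>.\<close>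
  have stay: "(ram_step ?P ^^ j) \<sigma> = \<sigma>" if "halted ?P \<sigma>" for j \<sigma>
    by (induction j) (use that in \<open>auto simp: ram_step_def\<close>)
  have "(ram_step ?P ^^ T) (initial_config xs) = (ram_step ?P ^^ t) (initial_config xs)"
    using stay[of "(ram_step ?P ^^ t) (initial_config xs)" "T - t"] t(1,2)
    by (simp add: halted_def flip: comp_apply[of "ram_step ?P ^^ (T - t)"] funpow_add)
  then show ?thesis
    using t by (simp add: ram_outputs_within_def halted_def)
qed

section \<open>The voting rule\<close>

text \<open>The state of the voting rule is a pair \<open>(d, out)\<close> of cell contents and elected candidates.
  The offices are given by pairs of a candidate and the cell of her office, which is
  nonzero once the office is filled; the ballots by pairs of a candidate and the cell with the
  balance of a voter who approves her.  Because subtraction is truncated, \<open>due\<close> vanishes iff the supporters can afford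
  the price, and \<open>pay\<close> needs no case distinction.\<close>

fun due :: "(nat \<times> nat) list \<Rightarrow> nat \<Rightarrow> (nat \<Rightarrow> nat) \<Rightarrow> nat \<Rightarrow> nat" where
  "due [] c d r = r"
| "due ((x, y) # ps) c d r = due ps c d (if x = c then r - d y else r)"

fun pay :: "(nat \<times> nat) list \<Rightarrow> nat \<Rightarrow> (nat \<Rightarrow> nat) \<Rightarrow> nat \<Rightarrow> nat \<Rightarrow> nat" where
  "pay [] c d r = d"
| "pay ((x, y) # ps) c d r =
     (if x = c then pay ps c (d(y := d y - r)) (r - d y) else pay ps c d r)"

fun visit ::
  "(nat \<times> nat) list \<Rightarrow> nat \<Rightarrow> nat \<times> nat \<Rightarrow> (nat \<Rightarrow> nat) \<times> nat list \<Rightarrow> (nat \<Rightarrow> nat) \<times> nat list"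
where
  "visit bs q (c, z) (d, out) =
     (if d z = 0 \<and> due bs c d q = 0 then ((pay bs c d q)(z := 1), out @ [c]) else (d, out))"

definition scan where
  "scan as bs q = fold (visit bs q) as"

definition tick :: "nat set \<Rightarrow> (nat \<Rightarrow> nat) \<Rightarrow> nat \<Rightarrow> nat" where
  "tick D d = (\<lambda>a. if a \<in> D then d a + 1 else d a)"

lemma tick_empty: "tick {} d = d"
  by (simp add: tick_def)

definition round where
  "round D as bs q s = scan as bs q (tick D (fst s), snd s)"

text \<open>At price \<open>0\<close> every vacant office can be filled.\<close>

definition phragmen where
  "phragmen D as bs k = scan as bs 0 ((round D as bs (card D) ^^ k) (\<lambda>_. 0, []))"

section \<open>Supporters, represented by their balance cells, and their payments\<close>

definition supporters :: "(nat \<times> nat) list \<Rightarrow> nat \<Rightarrow> nat set" where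
  "supporters bs c = {y. (c, y) \<in> set bs}"

lemma supporters_Nil [simp]: "supporters [] c = {}"
  by (simp add: supporters_def)

lemma supporters_Cons:
  "supporters ((x, y) # bs) c = (if x = c then insert y (supporters bs c) else supporters bs c)"
  by (auto simp: supporters_def)

lemma finite_supporters [simp]: "finite (supporters bs c)"
  by (induction bs) (auto simp: supporters_Cons)

text \<open>Successive truncated subtractions amount to one truncated subtraction of the sum;
  distinctness ensures that no balance is subtracted twice.\<close>

lemma due_eq: "distinct bs \<Longrightarrow> due bs c d r = r - sum d (supporters bs c)"
proof (induction bs c d r rule: due.induct)
  case (2 x y ps c d r)
  moreover from 2(2) have "x = c \<Longrightarrow> y \<notin> supporters ps c" by (simp add: supporters_def)
  ultimately show ?case by (auto simp: supporters_Cons)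
qed simp

lemma pay_le: "pay bs c d r a \<le> d a"
proof (induction bs c d r rule: pay.induct)
  case (2 x y ps c d r)
  have "(d(y := d y - r)) a \<le> d a" by simp
  with 2 show ?case by (fastforce intro: le_trans)
qed simp

lemma pay_other: "a \<notin> supporters bs c \<Longrightarrow> pay bs c d r a = d a"
  by (induction bs c d r rule: pay.induct) (auto simp: supporters_Cons)

text \<open>Each supporter pays the smaller of her balance and the amount still open, and the
  recursion passes on the rest. If the funds suffice, nothing remains open at the end.\<close>

lemma sum_pay:
  "distinct bs \<Longrightarrow> r \<le> sum d (supporters bs c) \<Longrightarrow>
     sum (pay bs c d r) (supporters bs c) + r = sum d (supporters bs c)"
proof (induction bs c d r rule: pay.induct)
  case (2 x y ps c d r)
  show ?case
  proof (cases "x = c")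
    case True
    let ?S = "supporters ps c" and ?d = "d(y := d y - r)"
    have y: "y \<notin> ?S" using 2(3) True by (simp add: supporters_def)
    \<comment> \<open>By distinctness the cell \<open>y\<close> does not occur again, so its new
      content does not affect the remaining supporters.\<close>
    have d: "sum ?d ?S = sum d ?S" using y by (intro sum.cong) auto
    have "sum (pay ps c ?d (r - d y)) ?S + (r - d y) = sum ?d ?S"
      using 2 True y d by (intro 2(1)) (auto simp: supporters_Cons)
    then show ?thesis
      using 2(4) True y d by (simp add: supporters_Cons pay_other)
  qed (use 2 in \<open>auto simp: supporters_Cons\<close>)
qed simp

section \<open>Invariants of the voting rule under a single visit\<close>

locale phragmen_setting =
  fixes D :: "nat set" and as bs :: "(nat \<times> nat) list"
  assumes finite_D: "finite D"
    and distinct_bs: "distinct bs"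
    and voters: "snd ` set bs \<subseteq> D"
    and offices: "snd ` set as \<inter> D = {}"
    and office_unique: "\<And>c z z'. (c, z) \<in> set as \<Longrightarrow> (c, z') \<in> set as \<Longrightarrow> z = z'"
begin

abbreviation "supp \<equiv> supporters bs"

lemma supp_subset: "supp c \<subseteq> D"
  using voters by (force simp: supporters_def)

definition approved :: "nat list \<Rightarrow> nat set \<Rightarrow> nat" where
  "approved out U = card {c \<in> set out. supp c \<inter> U \<noteq> {}}"

text \<open>The office cells record exactly which offices have a winner, and no office has
  two.\<close>

fun sound :: "(nat \<Rightarrow> nat) \<times> nat list \<Rightarrow> bool" where
  "sound (d, out) \<longleftrightarrow> distinct out \<and> set out \<subseteq> fst ` set as \<and>
     (\<forall>(c, z) \<in> set as. c \<in> set out \<longrightarrow> d z \<noteq> 0) \<and>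
     (\<forall>(c, z) \<in> set as. d z \<noteq> 0 \<longrightarrow> (\<exists>c' \<in> set out. (c', z) \<in> set as)) \<and>
     (\<forall>c c' z. c \<in> set out \<longrightarrow> c' \<in> set out \<longrightarrow> (c, z) \<in> set as \<longrightarrow> (c', z) \<in> set as \<longrightarrow> c = c')"

text \<open>Bookkeeping after \<open>t\<close> payouts at price \<open>q\<close>. A winner costs a
  group \<open>U\<close> nothing unless it contains a supporter, and at most \<open>q\<close>
  otherwise, whence the inequality. For all voters together the balance is exact.\<close>

fun ledger :: "nat \<Rightarrow> nat \<Rightarrow> (nat \<Rightarrow> nat) \<times> nat list \<Rightarrow> bool" where
  "ledger q t (d, out) \<longleftrightarrow>
     (\<forall>U \<subseteq> D. t * card U \<le> sum d U + q * approved out U) \<and> sum d D + q * length out = t * card D"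

text \<open>This is the goal of a visit: the office is filled, or the candidate is not
  affordable.\<close>

fun settled :: "nat \<Rightarrow> (nat \<Rightarrow> nat) \<times> nat list \<Rightarrow> nat \<times> nat \<Rightarrow> bool" where
  "settled q (d, out) (c, z) \<longleftrightarrow> d z \<noteq> 0 \<or> sum d (supp c) < q"

text \<open>The monotonicity along a scan that preserves \<open>settled\<close>: filled offices stay
  filled and balances only shrink.\<close>

fun advances :: "(nat \<Rightarrow> nat) \<times> nat list \<Rightarrow> (nat \<Rightarrow> nat) \<times> nat list \<Rightarrow> bool" where
  "advances (d, out) (d', out') \<longleftrightarrow>
     (\<forall>a. a \<notin> D \<longrightarrow> d a \<noteq> 0 \<longrightarrow> d' a \<noteq> 0) \<and> (\<forall>a \<in> D. d' a \<le> d a) \<and> set out \<subseteq> set out'"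

lemma advances_refl: "advances s s"
  by (cases s) auto

lemma advances_trans: "advances s s' \<Longrightarrow> advances s' s'' \<Longrightarrow> advances s s''"
  by (cases s; cases s'; cases s'') (auto, meson le_trans)

lemma visit_sound:
  assumes "x \<in> set as" "sound s"
  shows "sound (visit bs q x s)"
proof (cases s; cases x)
  fix d out c z assume [simp]: "s = (d, out)" "x = (c, z)"
  show "sound (visit bs q x s)"
  proof (cases "d z = 0 \<and> due bs c d q = 0")
    case True
    define d' where "d' = (pay bs c d q)(z := 1)"
    have v: "visit bs q (c, z) (d, out) = (d', out @ [c])" using True by (simp add: d'_def)
    \<comment> \<open>Payments touch only cells in \<open>D\<close>, so among the office cells only
      that of the new winner changes.\<close>
    have filled: "d' z' \<noteq> 0 \<longleftrightarrow> z' = z \<or> d z' \<noteq> 0" if "(c', z') \<in> set as" for c' z'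
    proof -
      have "z' \<notin> supp c" using that offices supp_subset[of c] by force
      then show ?thesis by (simp add: d'_def pay_other)
    qed
    have c: "(c, z) \<in> set as" using assms(1) by simp
    \<comment> \<open>An earlier winner for this office would have made its cell nonzero.\<close>
    have new: "c' \<notin> set out" if "(c', z) \<in> set as" for c'
      using that assms(2) True by auto
    have "d' z' \<noteq> 0" if "(c', z') \<in> set as" "c' \<in> set (out @ [c])" for c' z'
      using that assms(2) filled office_unique[OF c] by auto
    moreover have "\<exists>c' \<in> set (out @ [c]). (c', z') \<in> set as"
      if "(c'', z') \<in> set as" "d' z' \<noteq> 0" for c'' z'
      using that assms(2) filled c by auto
    moreover have "c\<^sub>1 = c\<^sub>2" if "c\<^sub>1 \<in> set (out @ [c])" "c\<^sub>2 \<in> set (out @ [c])"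
      "(c\<^sub>1, z') \<in> set as" "(c\<^sub>2, z') \<in> set as" for c\<^sub>1 c\<^sub>2 z'
      using that assms(2) new office_unique[OF c] by auto
    moreover have "c \<in> fst ` set as" using c by force
    ultimately show ?thesis
      using assms(2) new[OF c] by (auto simp: v simp del: visit.simps)
  qed (use assms(2) in auto)
qed

lemma visit_advances:
  assumes "x \<in> set as"
  shows "advances s (visit bs q x s)"
proof (cases s; cases x)
  fix d out c z assume [simp]: "s = (d, out)" "x = (c, z)"
  have "z \<notin> D" using assms offices by force
  moreover have "pay bs c d q a = d a" if "a \<notin> D" for a
    using that supp_subset[of c] by (intro pay_other) auto
  ultimately show ?thesis using pay_le by auto
qed

lemma visit_settled: "settled q (visit bs q x s) x"
  by (cases s; cases x) (auto simp: due_eq[OF distinct_bs])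

lemma settled_advances:
  assumes "settled q s x" "advances s s'" "x \<in> set as"
  shows "settled q s' x"
proof (cases s; cases x; cases s')
  fix d out c z d' out' assume [simp]: "s = (d, out)" "x = (c, z)" "s' = (d', out')"
  have "z \<notin> D" using assms offices by force
  moreover have "sum d' (supp c) \<le> sum d (supp c)"
    using assms(2) supp_subset[of c] by (intro sum_mono) auto
  ultimately show ?thesis using assms by auto
qed

text \<open>The supporters lose exactly \<open>q\<close> coins in total. A group without a supporter
  loses nothing; any other group loses at most \<open>q\<close>, while its count of approved winners
  grows by one.\<close>

lemma visit_ledger:
  assumes "x \<in> set as" "sound s" "ledger q t s"
  shows "ledger q t (visit bs q x s)"
proof (cases s; cases x)
  fix d out c z assume [simp]: "s = (d, out)" "x = (c, z)"
  show ?thesis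
  proof (cases "d z = 0 \<and> due bs c d q = 0")
    case True
    define d' where "d' = (pay bs c d q)(z := 1)"
    have v: "visit bs q (c, z) (d, out) = (d', out @ [c])" using True by (simp add: d'_def)
    have "z \<notin> D" using assms(1) offices by force
    then have d': "d' y = pay bs c d q y" if "y \<in> D" for y
      using that by (auto simp: d'_def)
    have le: "d' y \<le> d y" if "y \<in> D" for y by (simp add: d' that pay_le)
    have other: "d' y = d y" if "y \<in> D" "y \<notin> supp c" for y by (simp add: d' that pay_other)
    have q: "sum d' (supp c) + q = sum d (supp c)"
    proof -
      have "sum d' (supp c) = sum (pay bs c d q) (supp c)"
        using d' supp_subset by (intro sum.cong) auto
      then show ?thesis
        using sum_pay[OF distinct_bs, of q d c] True due_eq[OF distinct_bs, of c d q] by simp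
    qed
    have split: "sum f U = sum f (U - supp c) + sum f (U \<inter> supp c)" if "U \<subseteq> D"
      for f :: "nat \<Rightarrow> nat" and U
      using finite_subset[OF that finite_D] sum.Int_Diff[of U f "supp c"] by simp
    have same: "sum d' (U - supp c) = sum d (U - supp c)" if "U \<subseteq> D" for U
      using that other by (intro sum.cong) auto
    \<comment> \<open>The new winner is not yet listed, so she raises the count by exactly one for
      every group that has a supporter.\<close>
    have "c \<notin> set out" using assms(1,2) True by auto
    moreover have "{c' \<in> set (out @ [c]). supp c' \<inter> U \<noteq> {}} = {c' \<in> set out. supp c' \<inter> U \<noteq> {}} \<union>
        (if supp c \<inter> U = {} then {} else {c})" for U
      by auto
    ultimately have appr: "approved (out @ [c]) U =
        (if supp c \<inter> U = {} then approved out U else Suc (approved out U))" for U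
      unfolding approved_def by simp
    have paid: "sum d U \<le> sum d' U + (if supp c \<inter> U = {} then 0 else q)" if U: "U \<subseteq> D" for U
    proof (cases "supp c \<inter> U = {}")
      case False
      \<comment> \<open>The supporters outside \<open>U\<close> do not gain coins, so those inside
        \<open>U\<close> lose at most the whole price.\<close>
      have "sum d (supp c - U) + sum d (supp c \<inter> U) = sum d (supp c)"
        "sum d' (supp c - U) + sum d' (supp c \<inter> U) = sum d' (supp c)"
        by (simp_all add: sum.Int_Diff[of "supp c" _ U])
      moreover have "sum d' (supp c - U) \<le> sum d (supp c - U)"
        using le supp_subset by (intro sum_mono) auto
      ultimately have "sum d (U \<inter> supp c) \<le> sum d' (U \<inter> supp c) + q"
        using q by (simp add: Int_commute)
      then show ?thesis using False same[OF U] split[OF U] by auto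
    qed (use same[OF U] split[OF U] in \<open>simp add: Int_commute\<close>)
    have "t * card U \<le> sum d' U + q * approved (out @ [c]) U" if "U \<subseteq> D" for U
    proof -
      have "t * card U \<le> sum d U + q * approved out U" using that assms(3) by simp
      also have "\<dots> \<le> sum d' U + q * approved (out @ [c]) U"
        using paid[OF that] by (simp add: appr split: if_splits)
      finally show ?thesis .
    qed
    \<comment> \<open>All supporters lie in \<open>D\<close>, so the total drops by exactly the
      price.\<close>
    moreover have "sum d' D + q = sum d D"
      using split[of D] same[of D] q supp_subset[of c] by (simp add: Int_absorb1)
    ultimately show ?thesis using assms(3) by (auto simp: v algebra_simps simp del: visit.simps)
  next
    case False
    then show ?thesis using assms(3) by auto
  qed
qed

section \<open>From single visits to whole scans\<close>

lemma fold_visit_advances: "set xs \<subseteq> set as \<Longrightarrow> advances s (fold (visit bs q) xs s)"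
proof (induction xs arbitrary: s)
  case (Cons x xs)
  then show ?case
    using advances_trans[OF visit_advances[of x s q]] by (simp del: advances.simps visit.simps)
qed (simp add: advances_refl)

lemma scan_advances: "advances s (scan as bs q s)"
  unfolding scan_def by (rule fold_visit_advances) simp

lemma scan_sound: "sound s \<Longrightarrow> sound (scan as bs q s)"
proof -
  have "sound (fold (visit bs q) xs s)" if "sound s" "set xs \<subseteq> set as" for xs
    using that by (induction xs arbitrary: s) (auto simp: visit_sound simp del: visit.simps)
  then show "sound s \<Longrightarrow> sound (scan as bs q s)" by (simp add: scan_def)
qed

lemma scan_ledger: "sound s \<Longrightarrow> ledger q t s \<Longrightarrow> ledger q t (scan as bs q s)"
proof -
  have "ledger q t (fold (visit bs q) xs s)"
    if "sound s" "ledger q t s" "set xs \<subseteq> set as" for xs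
    using that
    by (induction xs arbitrary: s) (auto simp: visit_sound visit_ledger simp del: visit.simps)
  then show "sound s \<Longrightarrow> ledger q t s \<Longrightarrow> ledger q t (scan as bs q s)" by (simp add: scan_def)
qed

text \<open>The last visit to \<open>x\<close> settles it, and the visits after that one only
  advance the state.\<close>

lemma scan_settled: "x \<in> set as \<Longrightarrow> settled q (scan as bs q s) x"
proof -
  have "settled q (fold (visit bs q) xs s) x" if "set xs \<subseteq> set as" "x \<in> set xs" for xs
    using that
  proof (induction xs arbitrary: s)
    case (Cons y ys)
    show ?case
    proof (cases "x \<in> set ys")
      case True
      then show ?thesis using Cons by simp
    next
      case False
      then show ?thesis
        using Cons.prems settled_advances[OF visit_settled fold_visit_advances]
            by (simp del: visit.simps)
    qed
  qed simp
  then show "x \<in> set as \<Longrightarrow> settled q (scan as bs q s) x" by (simp add: scan_def)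
qed

section \<open>Rounds and the elected candidates\<close>

lemma tick_sound: "sound (d, out) \<Longrightarrow> sound (tick D d, out)"
proof -
  have "tick D d z = d z" if "(c, z) \<in> set as" for c z
    using that offices by (force simp: tick_def)
  then show "sound (d, out) \<Longrightarrow> sound (tick D d, out)" by auto
qed

lemma tick_ledger: "ledger q t (d, out) \<Longrightarrow> ledger q (Suc t) (tick D d, out)"
proof -
  have "sum (tick D d) U = sum d U + card U" if "U \<subseteq> D" for U
  proof -
    have "sum (tick D d) U = (\<Sum>a\<in>U. d a + 1)"
      using that by (intro sum.cong) (auto simp: tick_def)
    then show ?thesis by (simp only: sum.distrib) simp
  qed
  then show "ledger q t (d, out) \<Longrightarrow> ledger q (Suc t) (tick D d, out)" by auto
qed

lemma rounds_invariant:
  "sound ((round D as bs q ^^ t) (\<lambda>_. 0, [])) \<and> ledger q t ((round D as bs q ^^ t) (\<lambda>_. 0, []))"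
proof (induction t)
  case 0
  then show ?case by (auto simp: approved_def)
next
  case (Suc t)
  then show ?case
    by (cases "(round D as bs q ^^ t) (\<lambda>_. 0, [])")
      (simp add: round_def scan_sound scan_ledger tick_sound tick_ledger del: sound.simps
          ledger.simps)
qed

text \<open>In the last scan the price is \<open>0\<close>. No sum of balances lies below it, so
  \<open>settled\<close> can only mean that the office is filled; uniqueness is part of
  \<open>sound\<close>.\<close>

lemma phragmen_unique_winner:
  assumes "phragmen D as bs k = (d, out)" "(c, z) \<in> set as"
  shows "\<exists>!c. c \<in> set out \<and> (c, z) \<in> set as"
proof -
  have "sound (d, out)"
    unfolding assms(1)[symmetric] phragmen_def by (intro scan_sound) (use rounds_invariant in blast)
  moreover have "settled 0 (d, out) (c, z)"
    unfolding assms(1)[symmetric] phragmen_def by (intro scan_settled assms)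
  ultimately show ?thesis using assms(2) by fastforce
qed

lemma phragmen_distinct:
  assumes "phragmen D as bs k = (d, out)"
  shows "distinct out" "set out \<subseteq> fst ` set as"
proof -
  have "sound (d, out)"
    unfolding assms(1)[symmetric] phragmen_def by (intro scan_sound) (use rounds_invariant in blast)
  then show "distinct out" "set out \<subseteq> fst ` set as" by auto
qed

text \<open>This is the lower bound on the number of approved winners with the denominator cleared.
  It is strict because \<open>U\<close> owns fewer than \<open>card D\<close> coins after the paid
  rounds.\<close>

lemma phragmen_approved:
  assumes out': "phragmen D as bs k = (d', out')"
    and k: "k = card (snd ` set as)" and "k > 0" and "D \<noteq> {}" and U: "U \<subseteq> D"
    and cohesive: "\<And>z. z \<in> snd ` set as \<Longrightarrow> \<exists>c. (c, z) \<in> set as \<and> U \<subseteq> supp c"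
  shows "k * card U < card D * (approved out' U + 1)"
proof -
  let ?n = "card D"
  obtain d out where s: "(round D as bs ?n ^^ k) (\<lambda>_. 0, []) = (d, out)"
    by (metis surj_pair)
  have inv: "sound (d, out)" "ledger ?n k (d, out)"
    using rounds_invariant[of k ?n] s by (simp_all del: sound.simps ledger.simps)
  \<comment> \<open>The free scan at the end only adds winners, so it suffices to count those who
    were paid for.\<close>
  have "set out \<subseteq> set out'"
    using scan_advances[of "(d, out)" 0] out' s by (simp add: phragmen_def)
  then have mono: "approved out U \<le> approved out' U"
    unfolding approved_def by (intro card_mono) auto
  \<comment> \<open>Since \<open>k > 0\<close>, the last operation of the paid phase is a scan at
    price \<open>card D\<close>, which leaves everything settled.\<close>
  obtain k' where k': "k = Suc k'" using \<open>k > 0\<close> by (cases k) auto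
  have settled: "settled ?n (d, out) x" if "x \<in> set as" for x
    using scan_settled[OF that] unfolding s[symmetric] k' by (simp add: round_def)
  have n: "?n > 0" using finite_D \<open>D \<noteq> {}\<close> by (simp add: card_gt_0_iff)
  have "sum d U < ?n"
  proof (cases "\<exists>z \<in> snd ` set as. d z = 0")
    case True
    then obtain c z where "(c, z) \<in> set as" "U \<subseteq> supp c" "d z = 0"
      using cohesive by blast
    then have "sum d (supp c) < ?n" using settled by force
    moreover have "sum d U \<le> sum d (supp c)"
      using \<open>U \<subseteq> supp c\<close> by (intro sum_mono2) auto
    ultimately show ?thesis by simp
  next
    case False
    define office where "office c = (THE z. (c, z) \<in> set as)" for c
    have office: "office c = z" if "(c, z) \<in> set as" for c z
      unfolding office_def using that office_unique by blast
    have "\<exists>c \<in> set out. office c = z" if "z \<in> snd ` set as" for z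
      using False that inv(1) office by fastforce
    \<comment> \<open>Every office has a winner and every winner has only one office, so there are
      at least \<open>k\<close> winners.\<close>
    then have "snd ` set as \<subseteq> office ` set out" by (force simp: image_iff)
    then have "k \<le> card (set out)"
      unfolding k by (meson List.finite_set card_image_le card_mono finite_imageI le_trans)
    then have "k \<le> length out" using card_length le_trans by blast
    then have "?n * k \<le> ?n * length out" by simp
    moreover have "sum d D + ?n * length out = ?n * k" using inv(2) by (simp add: mult.commute)
    ultimately have "sum d D = 0" by linarith
    moreover have "sum d U \<le> sum d D" using U finite_D by (intro sum_mono2) auto
    ultimately show ?thesis using n by simp
  qed
  moreover have "k * card U \<le> sum d U + ?n * approved out U" using inv(2) U by simp
  moreover have "?n * approved out U \<le> ?n * approved out' U" using mono by simp
  ultimately show ?thesis unfolding distrib_left mult_1_right by linarith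
qed

end

section \<open>The machine program\<close>

abbreviation (input) "rOne \<equiv> 0 :: nat"
abbreviation (input) "rNil \<equiv> 1 :: nat"
abbreviation (input) "rK \<equiv> 2 :: nat"
abbreviation (input) "rN \<equiv> 3 :: nat"
abbreviation (input) "rCost \<equiv> 4 :: nat"
abbreviation (input) "rBal \<equiv> 5 :: nat"
abbreviation (input) "rAs \<equiv> 6 :: nat"
abbreviation (input) "rBs \<equiv> 7 :: nat"
abbreviation (input) "rEnd \<equiv> 8 :: nat"
abbreviation (input) "rT \<equiv> 9 :: nat"
abbreviation (input) "rP \<equiv> 10 :: nat"
abbreviation (input) "rLeft \<equiv> 11 :: nat"
abbreviation (input) "rC \<equiv> 12 :: nat"
abbreviation (input) "rO \<equiv> 13 :: nat"
abbreviation (input) "rM \<equiv> 14 :: nat"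
abbreviation (input) "rLen \<equiv> 15 :: nat"
abbreviation (input) "rX \<equiv> 16 :: nat"
abbreviation (input) "rH \<equiv> 17 :: nat"
abbreviation (input) "rDue \<equiv> 18 :: nat"
abbreviation (input) "rW \<equiv> 19 :: nat"
abbreviation (input) "rE \<equiv> 20 :: nat"
abbreviation (input) "rY \<equiv> 21 :: nat"
abbreviation (input) "rZ \<equiv> 22 :: nat"
abbreviation (input) "rU \<equiv> 23 :: nat"
abbreviation (input) "rS \<equiv> 24 :: nat"

text \<open>Registers below 32 are variables.  They are followed by one cell for each office, one cell for
  the balance of each voter, and then by the list of pairs (candidate, office cell) and the list of
  pairs (candidate, balance cell); \<open>rBal\<close>, \<open>rAs\<close>, \<open>rBs\<close> and \<open>rEnd\<close> point to the balances, to the two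
  lists and behind them.\<close>

definition read_lists :: com where
  "read_lists =
     While rM
       (Block [Read rLen] ;;
        While rLen
          (Block [Read rX, Store rH rX, Add rH rH rOne, Store rH rO, Add rH rH rOne,
             Sub rLen rLen rOne]) ;;
        Block [Add rO rO rOne, Sub rM rM rOne])"

text \<open>The sum of both truncated differences in \<open>rZ\<close> is zero iff the two
  candidates are equal. The inserted code finds the balance in \<open>rU\<close> and its address in
  \<open>rY\<close>.\<close>

definition for_supporters :: "instr list \<Rightarrow> com" where
  "for_supporters is =
     Block [Add rW rBs rNil, Sub rE rEnd rW, Add rDue rCost rNil] ;;
     While rE
       (Block [Load rX rW, Add rW rW rOne, Load rY rW, Add rW rW rOne, Sub rE rEnd rW,
          Sub rZ rX rC, Sub rS rC rX, Add rZ rZ rS] ;;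
        If0 rZ (Block ([Load rU rY] @ is @ [Sub rDue rDue rU])))"

definition scan_prog :: com where
  "scan_prog =
     Block [Add rP rAs rNil, Sub rLeft rBs rP] ;;
     While rLeft
       (Block [Load rC rP, Add rP rP rOne, Load rO rP, Add rP rP rOne, Sub rLeft rBs rP,
          Load rX rO] ;;
        If0 rX
          (for_supporters [] ;;
           If0 rDue
             (for_supporters [Sub rS rU rDue, Store rY rS] ;; Block [Store rO rOne, Write rC])))"

definition tick_prog :: com where
  "tick_prog =
     Block [Add rO rBal rNil, Add rM rN rNil] ;;
     While rM (Block [Load rX rO, Add rX rX rOne, Store rO rX, Add rO rO rOne, Sub rM rM rOne])"

definition setup_prog :: com where
  "setup_prog =
     Block [Const rOne 1, Read rK, Read rN, Const rO 32, Add rBal rO rK, Add rAs rBal rN,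
       Add rH rAs rNil, Add rM rK rNil] ;;
     read_lists ;;
     Block [Add rBs rH rNil, Add rM rN rNil] ;;
     read_lists ;;
     Block [Add rEnd rH rNil, Add rCost rN rNil, Add rT rK rNil]"

definition election_prog :: com where
  "election_prog =
     setup_prog ;;
     While rT (tick_prog ;; scan_prog ;; Block [Sub rT rT rOne]) ;;
     Block [Const rCost 0] ;;
     scan_prog"

section \<open>Memory contents as lists of pairs and as cells\<close>

definition stored :: "(nat \<Rightarrow> nat) \<Rightarrow> nat \<Rightarrow> (nat \<times> nat) list \<Rightarrow> bool" where
  "stored m p ps \<longleftrightarrow>
     (\<forall>i < length ps. m (p + 2 * i) = fst (ps ! i) \<and> m (p + 2 * i + 1) = snd (ps ! i))"

lemma stored_Nil [simp]: "stored m p []"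
  by (simp add: stored_def)

lemma stored_Cons [simp]:
  "stored m p ((x, y) # ps) \<longleftrightarrow> m p = x \<and> m (Suc p) = y \<and> stored m (Suc (Suc p)) ps"
  by (simp add: stored_def All_less_Suc2)

lemma stored_append: "stored m p (ps @ qs) \<longleftrightarrow> stored m p ps \<and> stored m (p + 2 * length ps) qs"
proof (induction ps arbitrary: p)
  case (Cons x ps)
  then show ?case by (cases x) (simp add: algebra_simps)
qed simp

lemma stored_upd:
  assumes "a < p \<or> p + 2 * length ps \<le> a"
  shows "stored (m(a := x)) p ps \<longleftrightarrow> stored m p ps"
proof -
  have "p + 2 * i \<noteq> a \<and> p + 2 * i + 1 \<noteq> a" if "i < length ps" for i
    using assms that by linarith
  then show ?thesis by (simp add: stored_def)
qed

text \<open>All other registers are masked by \<open>0\<close>, so that writes to variables and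
  lists leave the abstract state unchanged.\<close>

definition cells :: "nat \<Rightarrow> nat \<Rightarrow> (nat \<Rightarrow> nat) \<Rightarrow> nat \<Rightarrow> nat" where
  "cells k n m = (\<lambda>a. if 32 \<le> a \<and> a < 32 + k + n then m a else 0)"

lemma cells_upd:
  "cells k n (m(a := x)) = (if 32 \<le> a \<and> a < 32 + k + n then (cells k n m)(a := x) else cells k n m)"
  by (auto simp: cells_def)

lemma cells_zero: "\<forall>a. 32 \<le> a \<longrightarrow> a < 32 + k + n \<longrightarrow> m a = 0 \<Longrightarrow> cells k n m = (\<lambda>_. 0)"
  by (auto simp: cells_def)

fun pairs :: "nat \<Rightarrow> nat list list \<Rightarrow> (nat \<times> nat) list" where
  "pairs z [] = []"
| "pairs z (ys # yss) = map (\<lambda>c. (c, z)) ys @ pairs (Suc z) yss"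

definition enc :: "nat list list \<Rightarrow> nat list" where
  "enc yss = concat (map (\<lambda>ys. length ys # ys) yss)"

lemma enc_simps [simp]:
  "enc [] = []" "enc (ys # yss) = length ys # ys @ enc yss" "enc (xss @ yss) = enc xss @ enc yss"
  by (simp_all add: enc_def)

lemma read_lists_hoare:
  assumes one: "M rOne = 1" and p: "32 \<le> p" and L: "\<forall>ys \<in> set yss. length ys \<le> L"
  shows "hoare (length yss * (8 * L + 6) + 1)
     (\<lambda>(m, i, out). (\<forall>a<9. m a = M a) \<and> (\<forall>a. 32 \<le> a \<longrightarrow> a < p \<longrightarrow> m a = 0) \<and> out = [] \<and>
        i = enc yss @ rest \<and> m rM = length yss \<and> m rO = z \<and> stored m p ps \<and>
        m rH = p + 2 * length ps)
     read_lists
     (\<lambda>(m, i, out). (\<forall>a<9. m a = M a) \<and> (\<forall>a. 32 \<le> a \<longrightarrow> a < p \<longrightarrow> m a = 0) \<and> out = [] \<and>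
        i = rest \<and> m rO = z + length yss \<and> stored m p (ps @ pairs z yss) \<and>
        m rH = p + 2 * length (ps @ pairs z yss))"
proof -
  \<comment> \<open>The pairs already written, followed by the pairs \<open>qs\<close> still to
    come, form the final list.\<close>
  define K where "K m qs \<longleftrightarrow> (\<exists>ps'. stored m p ps' \<and> m rH = p + 2 * length ps' \<and>
      ps' @ qs = ps @ pairs z yss)" for m qs
  have K_upd: "K (m(a := x)) qs \<longleftrightarrow> K m qs" if "a < 32" "a \<noteq> rH" for m a x qs
    using that p by (simp add: K_def stored_upd)
  define J where "J xs yss' = (\<lambda>(m, i, out :: nat list). (\<forall>a<9. m a = M a) \<and>
      (\<forall>a. 32 \<le> a \<longrightarrow> a < p \<longrightarrow> m a = 0) \<and> out = [] \<and> i = xs @ enc yss' @ rest \<and>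
      m rLen = length xs \<and> m rM = Suc (length yss') \<and> m rO + Suc (length yss') = z + length yss \<and>
      (\<forall>ys \<in> set yss'. length ys \<le> L) \<and>
      K m (map (\<lambda>c. (c, m rO)) xs @ pairs (Suc (m rO)) yss'))" for xs yss'
  define I where "I yss' = (\<lambda>(m, i, out :: nat list). (\<forall>a<9. m a = M a) \<and>
      (\<forall>a. 32 \<le> a \<longrightarrow> a < p \<longrightarrow> m a = 0) \<and> out = [] \<and> i = enc yss' @ rest \<and>
      m rM = length yss' \<and> m rO + length yss' = z + length yss \<and> (\<forall>ys \<in> set yss'. length ys \<le> L) \<and>
      K m (pairs (m rO) yss'))" for yss'
  define inner where "inner = [Read rX, Store rH rX, Add rH rH rOne, Store rH rO, Add rH rH rOne,
             Sub rLen rLen rOne]"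
  have inner: "hoare 6 (J (x # xs) yss') (Block inner) (J xs yss')" for x xs yss'
  proof (rule hoare_Block)
    fix s assume J: "J (x # xs) yss' s"
    obtain m i out where s: "s = (m, i, out)" by (cases s)
    obtain ps' where ps': "stored m p ps'" "m rH = p + 2 * length ps'"
      "ps' @ map (\<lambda>c. (c, m rO)) (x # xs) @ pairs (Suc (m rO)) yss' = ps @ pairs z yss"
      using J by (auto simp: J_def K_def s)
    \<comment> \<open>An address in the form \<open>32 + w\<close> is visibly different from all
      variable registers, which lets simplification resolve the memory updates. The same device
      recurs below.\<close>
    define w where "w = p + 2 * length ps' - 32"
    have w: "m rH = 32 + w" "p + 2 * length ps' = 32 + w" "p \<le> 32 + w"
      using p by (simp_all add: ps' w_def)
    have one': "m rOne = Suc 0" using J one by (simp add: J_def s)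
    have "stored (m(16 := x, 32 + w := x, 17 := 33 + w, 33 + w := m 13, 17 := 34 + w,
        15 := length xs)) p (ps' @ [(x, m rO)])"
      using ps'(1) p w(3) by (simp add: stored_append stored_upd w(2))
    then have "K (m(16 := x, 32 + w := x, 17 := 33 + w, 33 + w := m 13, 17 := 34 + w,
        15 := length xs)) (map (\<lambda>c. (c, m rO)) xs @ pairs (Suc (m rO)) yss')"
      unfolding K_def using ps'(3) w(2) by (intro exI[of _ "ps' @ [(x, m rO)]"]) simp
    moreover have "fold eff inner s =
        (m(16 := x, 32 + w := x, 17 := 33 + w, 33 + w := m 13, 17 := 34 + w, 15 := length xs),
         xs @ enc yss' @ rest, out)"
      using J by (simp add: inner_def s J_def w(1) one')
    ultimately show "J xs yss' (fold eff inner s)"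
      using J p w(3) by (auto simp: J_def s)
  qed (simp_all add: inner_def)
  have loop: "hoare (8 * length xs + 1) (J xs yss') (While rLen (Block inner)) (J [] yss')"
    for xs yss'
    by (rule hoare_While_list[OF inner]) (auto simp: J_def)
  have body: "hoare (8 * L + 4) (I (ys # yss'))
     (Block [Read rLen] ;; While rLen (Block inner) ;;
      Block [Add rO rO rOne, Sub rM rM rOne]) (I yss')"
    for ys yss'
  proof (cases "length ys \<le> L")
    case True
    have "hoare 1 (I (ys # yss')) (Block [Read rLen]) (J ys yss')"
      by (rule hoare_Block) (use p in \<open>auto simp: I_def J_def K_upd\<close>)
    moreover have "hoare 2 (J [] yss') (Block [Add rO rO rOne, Sub rM rM rOne]) (I yss')"
      by (rule hoare_Block) (use p one in \<open>auto simp: I_def J_def K_upd\<close>)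
    ultimately show ?thesis
      using True by (intro hoare_Seq[OF _ hoare_Seq[OF loop _ order_refl]]) auto
  next
    case False
    then show ?thesis by (auto simp: hoare_def I_def store_of_def)
  qed
  have "hoare (length yss * (8 * L + 4 + 2) + 1) (I yss) read_lists (I [])"
    unfolding read_lists_def inner_def[symmetric]
    by (rule hoare_While_list[OF body]) (auto simp: I_def)
  then show ?thesis
    by (rule hoare_weaken) (use L in \<open>auto simp: I_def K_def\<close>)
qed

section \<open>Correctness of the subprograms for a fixed memory layout\<close>

locale layout =
  fixes k n :: nat and as bs :: "(nat \<times> nat) list"
  assumes office_cells: "snd ` set as \<subseteq> {32..<32 + k}"
    and voter_cells: "snd ` set bs \<subseteq> {32 + k..<32 + k + n}"
begin

text \<open>These contents stay fixed after the setup. The price \<open>rCost\<close> is left out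
  because it becomes \<open>0\<close> for the last scan.\<close>

definition lay :: "(nat \<Rightarrow> nat) \<Rightarrow> bool" where
  "lay m \<longleftrightarrow> m rOne = 1 \<and> m rNil = 0 \<and> m rK = k \<and> m rN = n \<and> m rBal = 32 + k \<and> m rAs = 32 + k + n \<and>
     m rBs = 32 + k + n + 2 * length as \<and> m rEnd = m rBs + 2 * length bs \<and>
     stored m (32 + k + n) (as @ bs)"

lemma lay_upd: "a = rCost \<or> rT \<le> a \<Longrightarrow> a < 32 + k + n \<Longrightarrow> lay (m(a := x)) \<longleftrightarrow> lay m"
  by (auto simp: lay_def stored_upd)

lemma layD:
  assumes "lay m"
  shows "m rOne = Suc 0" "m (Suc 0) = 0" "m rK = k" "m rN = n" "m rBal = 32 + k"
    "m rAs = 32 + k + n"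
    "m rBs = 32 + k + n + 2 * length as" "m rEnd = 32 + k + n + 2 * length as + 2 * length bs"
    "stored m (32 + k + n) as" "stored m (32 + k + n + 2 * length as) bs"
  using assms by (auto simp: lay_def stored_append)

text \<open>Variables of the outer loops, to be preserved by \<open>for_supporters\<close>.\<close>

definition frame :: "(nat \<Rightarrow> nat) \<Rightarrow> nat list" where
  "frame m = [m rCost, m rT, m rP, m rLeft, m rC, m rO]"

text \<open>The function \<open>F\<close> stands for \<open>pay\<close> if \<open>b\<close> holds and for \<open>due\<close> otherwise.\<close>

lemma for_supporters_hoare:
  fixes F :: "(nat \<times> nat) list \<Rightarrow> nat \<Rightarrow> (nat \<Rightarrow> nat) \<Rightarrow> nat \<Rightarrow> 'r"
  assumes F: "\<And>x y ps c d r. F ((x, y) # ps) c d r =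
      (if x = c then F ps c (if b then d(y := d y - r) else d) (r - d y) else F ps c d r)"
  shows "hoare (17 * length bs + 4)
     (\<lambda>(m, i, out). lay m \<and> cells k n m = d \<and> frame m = fr \<and> out = ou)
     (for_supporters (if b then [Sub rS rU rDue, Store rY rS] else []))
     (\<lambda>(m, i, out). lay m \<and> frame m = fr \<and> out = ou \<and>
        F [] (m rC) (cells k n m) (m rDue) = F bs (m rC) d (m rCost))"
proof -
  \<comment> \<open>Both functions carry their intermediate results as arguments, so their value on
    the unread part from the current state stays constant.\<close>
  define I where "I xs = (\<lambda>(m, i :: nat list, out). lay m \<and> frame m = fr \<and> out = ou \<and>
      32 + k + n \<le> m rW \<and> m rEnd = m rW + 2 * length xs \<and> m rE = 2 * length xs \<and>
      stored m (m rW) xs \<and> set xs \<subseteq> set bs \<and>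
      F xs (m rC) (cells k n m) (m rDue) = F bs (m rC) d (m rCost))" for xs
  have init: "hoare 3 (\<lambda>(m, i, out). lay m \<and> cells k n m = d \<and> frame m = fr \<and> out = ou)
      (Block [Add rW rBs rNil, Sub rE rEnd rW, Add rDue rCost rNil]) (I bs)"
    by (rule hoare_Block) (auto simp: I_def lay_upd layD frame_def cells_upd stored_upd)
  define body where "body =
      Block [Load rX rW, Add rW rW rOne, Load rY rW, Add rW rW rOne, Sub rE rEnd rW,
        Sub rZ rX rC, Sub rS rC rX, Add rZ rZ rS] ;;
      If0 rZ (Block ([Load rU rY] @ (if b then [Sub rS rU rDue, Store rY rS] else []) @
        [Sub rDue rDue rU]))"
  have body: "hoare 15 (I (x # xs)) body (I xs)" for x xs
  proof (rule hoare_fix, clarify)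
    fix m i out assume I: "I (x # xs) (m, i, out)"
    obtain w where w: "m rW = 32 + w" "k + n \<le> w"
      using I by (auto simp: I_def dest: le_Suc_ex)
    obtain c y where x: "x = (c, y)" by (cases x)
    \<comment> \<open>The address is that of a balance cell, so storing there keeps the layout
      intact.\<close>
    have "y \<in> {32 + k..<32 + k + n}" using I voter_cells by (auto simp: I_def x)
    then obtain v where y: "y = 32 + v" "k \<le> v" "v < k + n" by (auto dest: le_Suc_ex)
    have W: "m (32 + w) = c" "m (33 + w) = y" "m rEnd = 34 + w + 2 * length xs"
      "m rOne = Suc 0" "m (32 + v) = cells k n m (32 + v)"
      using I y by (auto simp: I_def x w cells_def dest: layD)
    show "hoare 15 (\<lambda>s'. s' = (m, i, out)) body (I xs)"
    proof (cases b)
      case True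
      show ?thesis
        unfolding body_def if_P[OF True] append.simps
        by (rule exec_Seq, simp, simp, simp add: w(1) W y(1), rule exec_If0, rule exec_Block;
            simp add: w(1) W y(1))
          (insert I w(2) y(2,3) True,
            auto simp: I_def F x w(1) y(1) W lay_upd cells_upd frame_def stored_upd)
    next
      case False
      show ?thesis
        unfolding body_def if_not_P[OF False] append.simps
        by (rule exec_Seq, simp, simp, simp add: w(1) W y(1), rule exec_If0, rule exec_Block;
            simp add: w(1) W y(1))
          (insert I w(2) y(2,3) False,
            auto simp: I_def F x w(1) y(1) W lay_upd cells_upd frame_def stored_upd)
    qed
  qed
  have loop: "hoare (17 * length bs + 1) (I bs) (While rE body) (I [])"
    by (rule hoare_While_list[OF body]) (auto simp: I_def)
  show ?thesis
    unfolding for_supporters_def body_def[symmetric]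
    by (rule hoare_Seq[OF init hoare_weaken[OF loop]]) (auto simp: I_def)
qed

text \<open>Returning \<open>d\<close> along with \<open>due\<close> makes the general triple also
  show that the balances are unchanged.\<close>

lemma weigh_hoare:
  "hoare (17 * length bs + 4) (\<lambda>(m, i, out). lay m \<and> cells k n m = d \<and> frame m = fr \<and> out = ou)
     (for_supporters [])
     (\<lambda>(m, i, out). lay m \<and> frame m = fr \<and> out = ou \<and> cells k n m = d \<and>
        m rDue = due bs (m rC) d (m rCost))"
  by (rule hoare_weaken[OF for_supporters_hoare[where b = False and
        F = "\<lambda>ps c d r. (d, due ps c d r)", unfolded if_False]]) auto

lemma settle_hoare:
  "hoare (17 * length bs + 4) (\<lambda>(m, i, out). lay m \<and> cells k n m = d \<and> frame m = fr \<and> out = ou)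
     (for_supporters [Sub rS rU rDue, Store rY rS])
     (\<lambda>(m, i, out). lay m \<and> frame m = fr \<and> out = ou \<and>
        cells k n m = pay bs (m rC) d (m rCost))"
  by (rule hoare_weaken[OF for_supporters_hoare[where b = True and F = pay, unfolded if_True]]) auto

lemma scan_hoare:
  "hoare (length as * (34 * length bs + 22) + 3)
     (\<lambda>(m, i, out). lay m \<and> m rCost = q \<and> m rT = t \<and> (cells k n m, out) = s)
     scan_prog
     (\<lambda>(m, i, out). lay m \<and> m rCost = q \<and> m rT = t \<and> (cells k n m, out) = scan as bs q s)"
proof -
  \<comment> \<open>Visiting the remaining offers from the current state yields the result of the
    whole scan; \<open>ys\<close> are the offers already visited.\<close>
  define I where "I xs = (\<lambda>(m, i :: nat list, out). lay m \<and> m rCost = q \<and> m rT = t \<and>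
      (\<exists>ys. as = ys @ xs \<and> m rP = 32 + k + n + 2 * length ys) \<and> m rLeft = 2 * length xs \<and>
      fold (visit bs q) xs (cells k n m, out) = scan as bs q s)" for xs
  let ?W = "17 * length bs + 4"
  have init: "hoare 2 (\<lambda>(m, i, out). lay m \<and> m rCost = q \<and> m rT = t \<and> (cells k n m, out) = s)
      (Block [Add rP rAs rNil, Sub rLeft rBs rP]) (I as)"
    by (rule hoare_Block) (auto simp: I_def lay_upd layD cells_upd scan_def)
  define inner where "inner = for_supporters [] ;;
      If0 rDue (for_supporters [Sub rS rU rDue, Store rY rS] ;; Block [Store rO rOne, Write rC])"
  define body where "body = Block [Load rC rP, Add rP rP rOne, Load rO rP, Add rP rP rOne,
      Sub rLeft rBs rP, Load rX rO] ;; If0 rX inner"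
  have inner: "hoare T (\<lambda>s'. s' = (m, i, out)) inner (I xs)"
    if "lay m" "m rCost = q" "m rT = t" "as = ys @ (c, z) # xs" "m rP = 34 + k + n + 2 * length ys"
      "m rLeft = 2 * length xs" "m rC = c" "m rO = z" "cells k n m z = 0"
      "fold (visit bs q) ((c, z) # xs) (cells k n m, out) = scan as bs q s"
      and T: "2 * ?W + 4 \<le> T" for m i out xs ys c z T
  proof -
    let ?d = "cells k n m"
    have z: "32 \<le> z" "z < 32 + k" using office_cells that(4) by auto
    then have lay_z: "lay m' \<Longrightarrow> lay (m'(z := y))" for m' y by (simp add: lay_upd)
    have weigh: "hoare ?W (\<lambda>s'. s' = (m, i, out)) (for_supporters [])
        (\<lambda>(m', i, out'). lay m' \<and> frame m' = frame m \<and> out' = out \<and> cells k n m' = ?d \<and>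
          m' rDue = due bs c ?d q)"
      by (rule hoare_weaken[OF weigh_hoare[of ?d "frame m" out]])
        (use that in \<open>auto simp: frame_def\<close>)
    show ?thesis
    proof (cases "due bs c ?d q = 0")
      case True
      have settle: "hoare ?W
          (\<lambda>(m', i, out'). lay m' \<and> frame m' = frame m \<and> out' = out \<and> cells k n m' = ?d)
          (for_supporters [Sub rS rU rDue, Store rY rS])
          (\<lambda>(m', i, out'). lay m' \<and> frame m' = frame m \<and> out' = out \<and> cells k n m' = pay bs c ?d q)"
        by (rule hoare_weaken[OF settle_hoare[of ?d "frame m" out]])
          (use that in \<open>auto simp: frame_def\<close>)
      have elect: "hoare 2
          (\<lambda>(m', i, out'). lay m' \<and> frame m' = frame m \<and> out' = out \<and> cells k n m' = pay bs c ?d q)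
          (Block [Store rO rOne, Write rC]) (I xs)"
        by (rule hoare_Block)
          (use that z True lay_z in \<open>auto simp: I_def frame_def cells_upd layD\<close>)
      show ?thesis
        unfolding inner_def
        by (rule hoare_Seq[OF weigh hoare_If0[OF hoare_weaken[OF hoare_Seq[OF settle elect
            order_refl]]]])
          (use True T in auto)
    next
      case False
      show ?thesis
        unfolding inner_def
      proof (rule hoare_Seq[OF weigh hoare_If0[where T = 0]])
        \<comment> \<open>The precondition is contradictory because the amount due is nonzero, so
          even the time bound \<open>0\<close> is valid.\<close>
        show "hoare 0 (\<lambda>s. (case s of (m', i, out') \<Rightarrow> lay m' \<and> frame m' = frame m \<and> out' = out \<and>
            cells k n m' = ?d \<and> m' rDue = due bs c ?d q) \<and> fst s rDue = 0)
          (for_supporters [Sub rS rU rDue, Store rY rS] ;; Block [Store rO rOne, Write rC]) (I xs)"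
          using False by (auto simp: hoare_def split: prod.splits)
      qed (use that False T in \<open>auto simp: I_def frame_def\<close>)
    qed
  qed
  have body: "hoare (2 * ?W + 12) (I (x # xs)) body (I xs)" for x xs
  proof (rule hoare_fix, clarify)
    fix m i out assume I: "I (x # xs) (m, i, out)"
    obtain c z where x: "x = (c, z)" by (cases x)
    obtain ys where ys: "as = ys @ (c, z) # xs" "m rP = 32 + k + n + 2 * length ys"
      using I by (auto simp: I_def x)
    define w where "w = k + n + 2 * length ys"
    have w: "m rP = 32 + w" using ys by (simp add: w_def)
    have "z \<in> {32..<32 + k}" using office_cells ys by auto
    then obtain v where z: "z = 32 + v" "v < k" by (auto dest: le_Suc_ex)
    have lay: "lay m" using I by (simp add: I_def)
    have "stored m (32 + w) ((c, z) # xs)"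
      using layD(9)[OF lay] by (simp add: ys(1) stored_append w_def add.assoc)
    then have entry: "m (32 + w) = c" "m (33 + w) = z" by simp_all
    have W: "m rBs = 34 + w + 2 * length xs" "m rOne = Suc 0" "m (32 + v) = cells k n m (32 + v)"
      using layD[OF lay] z by (simp_all add: ys(1) w_def cells_def)
    have I': "lay m" "m rCost = q" "m rT = t"
        "fold (visit bs q) ((c, z) # xs) (cells k n m, out) = scan as bs q s"
      using I by (simp_all add: I_def x)
    have next_as: "\<exists>ys'. as = ys' @ xs \<and> 34 + w = 32 + k + n + 2 * length ys'"
      using ys(1) by (intro exI[of _ "ys @ [(c, z)]"]) (simp add: w_def)
    show "hoare (2 * ?W + 12) (\<lambda>s'. s' = (m, i, out)) body (I xs)"
      unfolding body_def
    proof (rule exec_Seq, simp, simp, simp add: w entry W z(1), rule exec_If0, goal_cases)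
      case 1
      show ?case
        by (rule inner[OF _ _ _ ys(1)]; insert I' z(2) 1; simp add: z(1) w_def lay_upd cells_upd)
    next
      case 2
      then show ?case
        using I' z(2) next_as by (auto simp: I_def z(1) w_def lay_upd cells_upd)
    qed simp
  qed
  have loop: "hoare (length as * (2 * ?W + 12 + 2) + 1) (I as) (While rLeft body) (I [])"
    by (rule hoare_While_list[OF body]) (auto simp: I_def)
  show ?thesis
    unfolding scan_prog_def body_def[symmetric] inner_def[symmetric]
    by (rule hoare_Seq[OF init hoare_weaken[OF loop]]) (auto simp: I_def algebra_simps)
qed

lemma tick_hoare:
  "hoare (7 * n + 3)
     (\<lambda>(m, i, out). lay m \<and> m rCost = q \<and> m rT = t \<and> cells k n m = d \<and> out = ou)
     tick_prog
     (\<lambda>(m, i, out). lay m \<and> m rCost = q \<and> m rT = t \<and>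
        cells k n m = tick {32 + k..<32 + k + n} d \<and> out = ou)"
proof -
  \<comment> \<open>\<open>rO\<close> separates the balances already increased from the
    \<open>j\<close> others.\<close>
  define I where "I j = (\<lambda>(m, i :: nat list, out). lay m \<and> m rCost = q \<and> m rT = t \<and> out = ou \<and>
      m rM = j \<and> m rO + j = 32 + k + n \<and> 32 + k \<le> m rO \<and>
      cells k n m = tick {32 + k..<m rO} d)" for j
  have init: "hoare 2 (\<lambda>(m, i, out). lay m \<and> m rCost = q \<and> m rT = t \<and> cells k n m = d \<and> out = ou)
      (Block [Add rO rBal rNil, Add rM rN rNil]) (I n)"
    by (rule hoare_Block) (auto simp: I_def lay_upd layD cells_upd tick_empty)
  have body: "hoare 5 (I (Suc j))
      (Block [Load rX rO, Add rX rX rOne, Store rO rX, Add rO rO rOne, Sub rM rM rOne]) (I j)" for j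
  proof (rule hoare_Block, simp, clarify)
    fix m i out assume I: "I (Suc j) (m, i, out)"
    define v where "v = m rO - 32"
    have v: "m rO = 32 + v" "k \<le> v" "v + Suc j = k + n"
      using I by (auto simp: I_def v_def)
    have "cells k n m (32 + v) = tick {32 + k..<m rO} d (32 + v)" "lay m"
      using I by (simp_all add: I_def)
    then have W: "m (32 + v) = d (32 + v)" "m rOne = Suc 0"
      using v layD(1) by (simp_all add: tick_def cells_def)
    have upd: "(tick {32 + k..<32 + v} d)(32 + v := Suc (d (32 + v))) = tick {32 + k..<33 + v} d"
      using v by (auto simp: tick_def fun_eq_iff)
    show "I j (fold eff [Load rX rO, Add rX rX rOne, Store rO rX, Add rO rO rOne, Sub rM rM rOne]
        (m, i, out))"
      using I v(2,3) by (auto simp: I_def v(1) W lay_upd cells_upd upd)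
  qed simp
  have loop: "hoare (n * (5 + 2) + 1) (I n)
      (While rM (Block [Load rX rO, Add rX rX rOne, Store rO rX, Add rO rO rOne,
          Sub rM rM rOne])) (I 0)"
    by (rule hoare_While[where I = I, OF body]) (auto simp: I_def)
  show ?thesis
    unfolding tick_prog_def
    by (rule hoare_Seq[OF init hoare_weaken[OF loop]]) (auto simp: I_def)
qed

section \<open>Correctness and running time of the whole program\<close>

lemma setup_hoare:
  assumes as: "as = pairs 32 yss\<^sub>1" "length yss\<^sub>1 = k" "\<forall>ys \<in> set yss\<^sub>1. length ys \<le> L"
    and bs: "bs = pairs (32 + k) yss\<^sub>2" "length yss\<^sub>2 = n" "\<forall>ys \<in> set yss\<^sub>2. length ys \<le> L"
  shows "hoare ((k + n) * (8 * L + 6) + 15)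
     (\<lambda>s. s = (\<lambda>_. 0, k # n # enc (yss\<^sub>1 @ yss\<^sub>2), []))
     setup_prog
     (\<lambda>(m, i, out). lay m \<and> m rCost = n \<and> m rT = k \<and> (cells k n m, out) = (\<lambda>_. 0, []))"
proof -
  define M :: "nat \<Rightarrow> nat" where
    "M = (\<lambda>_. 0)(rOne := 1, rK := k, rN := n, rBal := 32 + k, rAs := 32 + k + n)"
  let ?p = "32 + k + n"
  \<comment> \<open>The flag \<open>r\<close> makes the condition on \<open>rM\<close> optional,
    since \<open>read_lists_hoare\<close> promises nothing about \<open>rM\<close>
    afterwards.\<close>
  define P where "P M ps z r j i' = (\<lambda>(m, i, out :: nat list). (\<forall>a<9. m a = M a) \<and>
      (\<forall>a. 32 \<le> a \<longrightarrow> a < ?p \<longrightarrow> m a = 0) \<and> out = [] \<and> i = i' \<and> (r \<longrightarrow> m rM = j) \<and>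
      m rO = z \<and> stored m ?p ps \<and> m rH = ?p + 2 * length ps)"
    for M :: "nat \<Rightarrow> nat" and ps z r j and i' :: "nat list"
  let ?M = "M(rBs := ?p + 2 * length as)"
  have init: "hoare 8 (\<lambda>s. s = (\<lambda>_. 0, k # n # enc (yss\<^sub>1 @ yss\<^sub>2), []))
      (Block [Const rOne 1, Read rK, Read rN, Const rO 32, Add rBal rO rK, Add rAs rBal rN,
       Add rH rAs rNil, Add rM rK rNil]) (P M [] 32 True k (enc yss\<^sub>1 @ enc yss\<^sub>2))"
    by (rule hoare_Block) (auto simp: P_def M_def)
  have read\<^sub>1: "hoare (k * (8 * L + 6) + 1) (P M [] 32 True k (enc yss\<^sub>1 @ enc yss\<^sub>2)) read_lists
      (P M as (32 + k) False 0 (enc yss\<^sub>2))"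
    by (rule hoare_weaken[OF read_lists_hoare[where M = M and p = ?p and yss = yss\<^sub>1 and
        L = L and ps = "[]" and z = 32 and rest = "enc yss\<^sub>2"]])
      (use as in \<open>auto simp: P_def M_def\<close>)
  have mid: "hoare 2 (P M as (32 + k) False 0 (enc yss\<^sub>2)) (Block [Add rBs rH rNil, Add rM rN rNil])
      (P ?M as (32 + k) True n (enc yss\<^sub>2))"
    by (rule hoare_Block) (auto simp: P_def M_def stored_upd)
  have read\<^sub>2: "hoare (n * (8 * L + 6) + 1) (P ?M as (32 + k) True n (enc yss\<^sub>2)) read_lists
      (P ?M (as @ bs) (32 + k + n) False 0 [])"
    by (rule hoare_weaken[OF read_lists_hoare[where M = ?M and p = ?p and yss = yss\<^sub>2 and
        L = L and ps = as and z = "32 + k" and rest = "[]"]])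
      (use bs in \<open>auto simp: P_def M_def\<close>)
  have fin: "hoare 3 (P ?M (as @ bs) (32 + k + n) False 0 [])
     (Block [Add rEnd rH rNil, Add rCost rN rNil, Add rT rK rNil])
     (\<lambda>(m, i, out). lay m \<and> m rCost = n \<and> m rT = k \<and> (cells k n m, out) = (\<lambda>_. 0, []))"
    by (rule hoare_Block) (auto simp: P_def M_def lay_def stored_upd intro!: cells_zero)
  show ?thesis
    unfolding setup_prog_def
    by (rule hoare_Seq[OF init hoare_Seq[OF read\<^sub>1 hoare_Seq[OF mid hoare_Seq[OF read\<^sub>2 fin]]]])
      (auto simp: algebra_simps)
qed

lemma election_hoare:
  assumes as: "as = pairs 32 yss\<^sub>1" "length yss\<^sub>1 = k" "\<forall>ys \<in> set yss\<^sub>1. length ys \<le> L"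
    and bs: "bs = pairs (32 + k) yss\<^sub>2" "length yss\<^sub>2 = n" "\<forall>ys \<in> set yss\<^sub>2. length ys \<le> L"
  shows "hoare ((k + n) * (8 * L + 6) + k * (length as * (34 * length bs + 22) + 7 * n + 9) +
       length as * (34 * length bs + 22) + 20)
     (\<lambda>s. s = (\<lambda>_. 0, k # n # enc (yss\<^sub>1 @ yss\<^sub>2), []))
     election_prog
     (\<lambda>(m, i, out). out = snd (phragmen {32 + k..<32 + k + n} as bs k))"
proof -
  let ?D = "{32 + k..<32 + k + n}" and ?W = "length as * (34 * length bs + 22) + 3"
  \<comment> \<open>The counter \<open>j\<close> holds the number of rounds still to come, so
    \<open>k - j\<close> rounds are done.\<close>
  define I where "I j = (\<lambda>(m, i :: nat list, out). lay m \<and> m rCost = n \<and> m rT = j \<and> j \<le> k \<and>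
      (cells k n m, out) = (round ?D as bs n ^^ (k - j)) (\<lambda>_. 0, []))" for j
  have body: "hoare (7 * n + 3 + ?W + 1) (I (Suc j))
      (tick_prog ;; scan_prog ;; Block [Sub rT rT rOne]) (I j)" for j
  proof (cases "Suc j \<le> k")
    case True
    obtain d ou where s: "(round ?D as bs n ^^ (k - Suc j)) (\<lambda>_. 0, []) = (d, ou)"
      by (metis surj_pair)
    have "k - j = Suc (k - Suc j)" using True by simp
    then have s': "(round ?D as bs n ^^ (k - j)) (\<lambda>_. 0, []) = scan as bs n (tick ?D d, ou)"
      by (simp add: s round_def)
    have tick: "hoare (7 * n + 3) (I (Suc j)) tick_prog
      (\<lambda>(m, i, out). lay m \<and> m rCost = n \<and> m rT = Suc j \<and> (cells k n m, out) = (tick ?D d, ou))"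
      by (rule hoare_weaken[OF tick_hoare[of n "Suc j" d ou]]) (auto simp: I_def s)
    have dec: "hoare 1 (\<lambda>(m, i, out). lay m \<and> m rCost = n \<and> m rT = Suc j \<and>
        (cells k n m, out) = scan as bs n (tick ?D d, ou)) (Block [Sub rT rT rOne]) (I j)"
      by (rule hoare_Block) (use True lay_upd[of rT] in \<open>auto simp: I_def s' cells_upd layD(1)\<close>)
    show ?thesis
      by (rule hoare_Seq[OF tick hoare_Seq[OF scan_hoare dec order_refl]]) simp
  next
    case False
    then show ?thesis by (auto simp: hoare_def I_def store_of_def)
  qed
  have loop: "hoare (k * (7 * n + 3 + ?W + 1 + 2) + 1) (I k)
      (While rT (tick_prog ;; scan_prog ;; Block [Sub rT rT rOne])) (I 0)"
    by (rule hoare_While[where I = I, OF body]) (auto simp: I_def)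
  let ?s = "(round ?D as bs n ^^ k) (\<lambda>_. 0, [])"
  have zero: "hoare 1 (I 0) (Block [Const rCost 0])
      (\<lambda>(m, i, out). lay m \<and> m rCost = 0 \<and> m rT = 0 \<and> (cells k n m, out) = ?s)"
    by (rule hoare_Block) (use lay_upd[of rCost] in \<open>auto simp: I_def cells_upd\<close>)
  have last: "hoare ?W (\<lambda>(m, i, out). lay m \<and> m rCost = 0 \<and> m rT = 0 \<and> (cells k n m, out) = ?s)
      scan_prog (\<lambda>(m, i, out). out = snd (phragmen ?D as bs k))"
    by (rule hoare_weaken[OF scan_hoare[of 0 0 ?s]])
      (auto simp: phragmen_def dest: arg_cong[where f = snd])
  have ready: "hoare ((k + n) * (8 * L + 6) + 15)
     (\<lambda>s. s = (\<lambda>_. 0, k # n # enc (yss\<^sub>1 @ yss\<^sub>2), [])) setup_prog (I k)"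
    by (rule hoare_weaken[OF setup_hoare[OF assms]]) (auto simp: I_def)
  show ?thesis
    unfolding election_prog_def
    by (rule hoare_Seq[OF ready hoare_Seq[OF loop hoare_Seq[OF zero last order_refl] order_refl]])
      (simp add: algebra_simps)
qed

end

section \<open>Elections\<close>

lemma set_pairs:
  "(c, a) \<in> set (pairs z yss) \<longleftrightarrow> (\<exists>j < length yss. a = z + j \<and> c \<in> set (yss ! j))"
proof (induction z yss rule: pairs.induct)
  case (2 z ys yss)
  have "(\<exists>j < length (ys # yss). a = z + j \<and> c \<in> set ((ys # yss) ! j)) \<longleftrightarrow>
      a = z \<and> c \<in> set ys \<or> (\<exists>j < length yss. a = Suc z + j \<and> c \<in> set (yss ! j))"
    by (simp add: Ex_less_Suc2)
  with 2 show ?case by auto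
qed simp

lemma distinct_pairs: "\<forall>ys \<in> set yss. distinct ys \<Longrightarrow> distinct (pairs z yss)"
proof (induction z yss rule: pairs.induct)
  case (2 z ys yss)
  then show ?case
    by (auto simp: distinct_map inj_on_def set_pairs)
qed simp

text \<open>Each list contributes one entry for its length and one per member, so the number of
  pairs is bounded by the input length.\<close>

lemma length_enc: "length (enc yss) = length yss + length (pairs z yss)"
  by (induction z yss rule: pairs.induct) auto

lemma length_le_enc: "ys \<in> set yss \<Longrightarrow> length ys \<le> length (enc yss)"
  by (induction yss) auto

lemma length_le_input_size: "length xs \<le> input_size xs"
  unfolding input_size_def by (induction xs) auto

lemma computable_fun_const: "computable_fun (\<lambda>_. c)"
  unfolding computable_fun_def
proof (intro exI allI)
  show "ram_outputs_within (compile 0 (Block [Const 0 c, Write 0])) [n] 2 [c]" for n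
    by (rule hoare_program, rule hoare_Block) auto
qed

text \<open>The coefficients result from replacing every parameter of the running time in
  \<open>election_hoare\<close> by the input size and expanding.\<close>

definition time_poly :: "nat poly" where
  "time_poly = [:20, 37, 71, 34:]"

lemma poly_mono_nat: "x \<le> y \<Longrightarrow> poly p x \<le> poly (p :: nat poly) y"
  by (induction p) (auto intro: add_mono mult_mono)

lemma election_time:
  assumes "k \<le> N" "n \<le> N" "k + n \<le> N" "L \<le> N" "a \<le> N" "b \<le> N"
  shows "(k + n) * (8 * L + 6) + k * (a * (34 * b + 22) + 7 * n + 9) + a * (34 * b + 22) + 20
    \<le> poly time_poly (N :: nat)"
proof -
  have "(k + n) * (8 * L + 6) + k * (a * (34 * b + 22) + 7 * n + 9) + a * (34 * b + 22) + 20 \<le>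
      N * (8 * N + 6) + N * (N * (34 * N + 22) + 7 * N + 9) + N * (34 * N + 22) + 20"
    using assms by (intro add_mono mult_mono order_refl) auto
  also have "\<dots> \<le> poly time_poly N"
    by (simp add: time_poly_def algebra_simps)
  finally show ?thesis .
qed

section \<open>The voting rule applied to an encoded election\<close>

locale encoded_election =
  fixes E :: "nat election" and as vs :: "nat list list"
  assumes inst: "election_instance E"
    and as: "list_all2 enumerates as (map (candidates E) [1..<offices E + 1])"
    and vs: "list_all2 enumerates vs (map (ballot E) [1..<voters E + 1])"
begin

abbreviation "k \<equiv> offices E"
abbreviation "n \<equiv> voters E"
abbreviation "D \<equiv> {32 + k..<32 + k + n}"
abbreviation "offers \<equiv> pairs 32 as"
abbreviation "approvals \<equiv> pairs (32 + k) vs"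

lemma length_as: "length as = k" and length_vs: "length vs = n"
  using as vs by (auto dest: list_all2_lengthD)

lemma nth_as: "j < k \<Longrightarrow> enumerates (as ! j) (candidates E (Suc j))"
  using list_all2_nthD[OF as, of j] by (simp add: length_as del: upt_Suc)

lemma nth_vs: "i < n \<Longrightarrow> enumerates (vs ! i) (ballot E (Suc i))"
  using list_all2_nthD[OF vs, of i] by (simp add: length_vs del: upt_Suc)

text \<open>Offices are numbered from \<open>1\<close> but their cells from \<open>32\<close>, hence
  the offset \<open>31\<close>.\<close>

lemma offers_iff: "(c, a) \<in> set offers \<longleftrightarrow> (\<exists>j \<in> {1..k}. a = 31 + j \<and> c \<in> candidates E j)"
proof -
  have "(c, a) \<in> set offers \<longleftrightarrow> (\<exists>j < k. a = 32 + j \<and> c \<in> candidates E (Suc j))"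
    by (use nth_as in \<open>auto simp: set_pairs length_as enumerates_def\<close>)
  also have "\<dots> \<longleftrightarrow> (\<exists>j \<in> Suc ` {..<k}. a = 31 + j \<and> c \<in> candidates E j)" by auto
  finally show ?thesis by (simp add: image_Suc_lessThan)
qed

lemma approvals_iff: "(c, a) \<in> set approvals \<longleftrightarrow> (\<exists>i \<in> {1..n}. a = 31 + k + i \<and> c \<in> ballot E i)"
proof -
  have "(c, a) \<in> set approvals \<longleftrightarrow> (\<exists>i < n. a = 32 + k + i \<and> c \<in> ballot E (Suc i))"
    by (use nth_vs in \<open>auto simp: set_pairs length_vs enumerates_def\<close>)
  also have "\<dots> \<longleftrightarrow> (\<exists>i \<in> Suc ` {..<n}. a = 31 + k + i \<and> c \<in> ballot E i)" by auto
  finally show ?thesis by (simp add: image_Suc_lessThan)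
qed

sublocale layout k n offers approvals
  by unfold_locales (auto simp: offers_iff approvals_iff)

sublocale phragmen_setting D offers approvals
proof
  show "distinct approvals"
    using nth_vs by (intro distinct_pairs) (auto simp: in_set_conv_nth length_vs enumerates_def)
  fix c z z' assume "(c, z) \<in> set offers" "(c, z') \<in> set offers"
  then obtain j j' where j: "j \<in> {1..k}" "z = 31 + j" "c \<in> candidates E j"
    and j': "j' \<in> {1..k}" "z' = 31 + j'" "c \<in> candidates E j'"
    unfolding offers_iff by blast
  have "disjoint_family_on (candidates E) {1..k}" using inst by (simp add: election_instance_def)
  from disjoint_family_onD[OF this j(1) j'(1)] have "j = j'"
    using j(3) j'(3) by blast
  then show "z = z'" using j j' by simp
qed (auto simp: offers_iff approvals_iff)

definition winners :: "nat list" where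
  "winners = snd (phragmen D offers approvals k)"

lemma phragmen_winners: "\<exists>d. phragmen D offers approvals k = (d, winners)"
  by (metis winners_def prod.collapse)

lemma winners_computed:
  assumes xs: "xs = k # n # enc (as @ vs)"
  shows "ram_outputs_within (compile 0 election_prog) xs (poly time_poly (input_size xs)) winners"
proof (rule hoare_program, rule hoare_weaken)
  let ?L = "length (enc (as @ vs))"
  show "hoare ((k + n) * (8 * ?L + 6) +
       k * (length offers * (34 * length approvals + 22) + 7 * n + 9) +
       length offers * (34 * length approvals + 22) + 20)
     (\<lambda>s. s = (\<lambda>_. 0, k # n # enc (as @ vs), [])) election_prog (\<lambda>(m, i, out). out = winners)"
    unfolding winners_def
    by (rule election_hoare[OF refl length_as _ refl length_vs])
      (auto simp del: enc_simps intro: length_le_enc)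
  \<comment> \<open>Two entries for \<open>k\<close> and \<open>n\<close>, one for each list and one
    for each pair: every parameter of the running time is at most the input length.\<close>
  have "length xs = 2 + (k + length offers) + (n + length approvals)"
    by (simp add: xs length_enc[of as 32] length_enc[of vs "32 + k"] length_as length_vs)
  moreover have "?L \<le> length xs" by (simp add: xs)
  ultimately have "(k + n) * (8 * ?L + 6) +
       k * (length offers * (34 * length approvals + 22) + 7 * n + 9) +
       length offers * (34 * length approvals + 22) + 20 \<le> poly time_poly (length xs)"
    by (intro election_time) auto
  also have "\<dots> \<le> poly time_poly (input_size xs)"
    by (intro poly_mono_nat length_le_input_size)
  finally show "(k + n) * (8 * ?L + 6) +
       k * (length offers * (34 * length approvals + 22) + 7 * n + 9) +
       length offers * (34 * length approvals + 22) + 20 \<le> poly time_poly (input_size xs)" .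
qed (auto simp: xs)

lemma distinct_winners: "distinct winners"
  using phragmen_winners phragmen_distinct by blast

lemma winners_allocation: "office_allocation E (set winners)"
proof -
  obtain d where d: "phragmen D offers approvals k = (d, winners)" using phragmen_winners by blast
  have unique: "\<exists>!c. c \<in> set winners \<and> c \<in> candidates E j" if j: "j \<in> {1..k}" for j
  proof -
    have eq: "(c, 31 + j) \<in> set offers \<longleftrightarrow> c \<in> candidates E j" for c
      using j by (auto simp: offers_iff)
    have "candidates E j \<noteq> {}" using inst j by (auto simp: election_instance_def)
    then obtain c where "(c, 31 + j) \<in> set offers" using eq by blast
    from phragmen_unique_winner[OF d this] show ?thesis by (simp only: eq)
  qed
  define w where "w j = (THE c. c \<in> set winners \<and> c \<in> candidates E j)" for j
  have w: "w j \<in> set winners \<and> w j \<in> candidates E j" if "j \<in> {1..k}" for j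
    unfolding w_def by (rule theI'[OF unique[OF that]])
  have "set winners \<subseteq> w ` {1..k}"
  \<comment> \<open>Every winner is a candidate for some office, and there she is the unique winner
    chosen by \<open>w\<close>.\<close>
  proof
    fix c assume c: "c \<in> set winners"
    then obtain a where "(c, a) \<in> set offers"
      using phragmen_distinct(2)[OF d] by force
    then obtain j where "j \<in> {1..k}" "c \<in> candidates E j" using offers_iff by blast
    then show "c \<in> w ` {1..k}" using unique w c by blast
  qed
  then have "set winners = w ` {1..k}" using w by auto
  then show ?thesis unfolding office_allocation_def using w by blast
qed

text \<open>The group \<open>V'\<close> corresponds to the set \<open>?U\<close> of its balance
  cells, and its agreement on every office is the cohesiveness required by
  \<open>phragmen_approved\<close>.\<close>

lemma winners_global_PJR: "global_PJR E (set winners)"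
  unfolding global_PJR_def
proof (intro allI impI, elim conjE)
  fix V' assume V': "V' \<subseteq> {1..n}" "V' \<noteq> {}"
    and cohesive: "\<forall>j\<in>{1..k}. (\<Inter>i\<in>V'. ballot E i) \<inter> candidates E j \<noteq> {}"
  obtain d where d: "phragmen D offers approvals k = (d, winners)" using phragmen_winners by blast
  let ?U = "(\<lambda>i. 31 + k + i) ` V'"
  have pos: "k \<ge> 1" "n \<ge> 1" using inst by (auto simp: election_instance_def)
  \<comment> \<open>Candidate sets are nonempty, so every office occurs among the offers and exactly
    \<open>k\<close> office cells are counted.\<close>
  have "snd ` set offers = (\<lambda>j. 31 + j) ` {1..k}"
  proof (intro equalityI subsetI)
    fix z assume "z \<in> (\<lambda>j. 31 + j) ` {1..k}"
    then obtain j where j: "j \<in> {1..k}" "z = 31 + j" by blast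
    then obtain c where "c \<in> candidates E j" using inst unfolding election_instance_def by blast
    then have "(c, z) \<in> set offers" using j by (auto simp: offers_iff)
    then show "z \<in> snd ` set offers" by force
  qed (auto simp: offers_iff)
  then have card_offices: "k = card (snd ` set offers)"
    by (simp add: card_image)
  have supp: "a \<in> supp c \<longleftrightarrow> (\<exists>i \<in> {1..n}. a = 31 + k + i \<and> c \<in> ballot E i)" for a c
    by (simp add: supporters_def approvals_iff)
  have "k * card ?U < card D * (approved winners ?U + 1)"
  proof (rule phragmen_approved[OF d card_offices])
    show "k > 0" "D \<noteq> {}" "?U \<subseteq> D" using pos V' by auto
    fix z assume "z \<in> snd ` set offers"
    then obtain j where j: "j \<in> {1..k}" "z = 31 + j" by (auto simp: offers_iff)
    then obtain c where "c \<in> (\<Inter>i\<in>V'. ballot E i)" "c \<in> candidates E j" using cohesive by blast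
    then show "\<exists>c. (c, z) \<in> set offers \<and> ?U \<subseteq> supp c"
      using j V' by (intro exI[of _ c]) (auto simp: offers_iff supp)
  qed
  moreover have "card ?U = card V'" by (simp add: card_image)
  moreover have "{c \<in> set winners. supp c \<inter> ?U \<noteq> {}} = set winners \<inter> (\<Union>i\<in>V'. ballot E i)"
  proof -
    have "supp c \<inter> ?U \<noteq> {} \<longleftrightarrow> (\<exists>i \<in> V'. c \<in> ballot E i)" for c
    proof -
      have "31 + k + i \<in> supp c \<longleftrightarrow> c \<in> ballot E i" if "i \<in> V'" for i
        using V'(1) that by (auto simp: supp)
      then show ?thesis by blast
    qed
    then show ?thesis by auto
  qed
  ultimately have "k * card V' < n * (card (set winners \<inter> (\<Union>i\<in>V'. ballot E i)) + 1)"
      (is "_ < n * (?c + 1)")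
    by (simp add: approved_def)
  then have "real (k * card V') < real (n * (?c + 1))" by linarith
  then have "real (card V') / real n * real k < real ?c + 1"
    using pos by (simp add: field_simps)
  \<comment> \<open>The floor of a real is at most the integer \<open>?c\<close> iff the real is
    less than \<open>?c + 1\<close>, so the strict bound absorbs the rounding.\<close>
  then show "\<lfloor>real (card V') / real n * real k\<rfloor> \<le> int ?c"
    by (simp add: floor_le_iff)
qed

end

theorem proposition3:
  "\<exists>(f :: nat \<Rightarrow> nat) (p :: nat poly) (P :: instr list).
     computable_fun f \<and>
     (\<forall>(E :: nat election) xs.
        election_instance E \<and> encodes_election xs E \<longrightarrow>
        (\<exists>ys X. ram_outputs_within P xs (f (voters E) * poly p (input_size xs)) ys \<and>
                enumerates ys X \<and> office_allocation E X \<and> global_PJR E X))"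
proof (intro exI[of _ "\<lambda>_. 1"] exI[of _ time_poly] exI[of _ "compile 0 election_prog"]
      conjI allI impI)
  show "computable_fun (\<lambda>_. 1)" by (rule computable_fun_const)
  fix E :: "nat election" and xs assume "election_instance E \<and> encodes_election xs E"
  then obtain as vs where enc: "encoded_election E as vs"
    and xs: "xs = offices E # voters E # enc (as @ vs)"
    by (auto simp: encodes_election_def encoded_election_def enc_def)
  interpret encoded_election E as vs by (rule enc)
  have "ram_outputs_within (compile 0 election_prog) xs (1 * poly time_poly (input_size xs)) winners"
    using winners_computed[OF xs] by simp
  moreover have "enumerates winners (set winners)"
    by (simp add: enumerates_def distinct_winners)
  ultimately show "\<exists>ys X. ram_outputs_within (compile 0 election_prog) xs
      (1 * poly time_poly (input_size xs)) ys \<and>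
      enumerates ys X \<and> office_allocation E X \<and> global_PJR E X"
    using winners_allocation winners_global_PJR by blast
qed

end
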